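(* Let $A,n,r,e,f$ be non-negative integers with $e+f\le A(n+1)-2$. Let $S=A$ if $r\ge n+1$ and $S=2A$ otherwise. Then the series $$\sum_{k_1\ge k_2\ge1}\frac{(k_1+k_2+n+r)^e(k_1-k_2+r)^f}{(k_1+r)_{n+1}^A(k_2)_{n+1}^A}$$ is a linear combination with rational coefficients of $1$, of $\zeta(s)$ with $2\le s\le S$, and of: - if $e$ and $f$ are even: $\zeta(s,s')+\zeta(s',s)$ with $2\le s\le s'\le A$ and $s'\equiv s\pmod2$; - if $e$ is even and $f$ is odd: $\zeta(s,s')-\zeta(s',s)$ with $2\le s<s'\le A$ and $s'\not\equiv s\pmod2$; - if $e$ is odd and $f$ is even: $\zeta(s,s')+\zeta(s',s)$ with $2\le s<s'\le A$ and $s'\not\equiv s\pmod2$; - if $e$ and $f$ are odd: $\zeta(s,s')-\zeta(s',s)$ with $2\le s<s'\le A$ and $s'\equiv s\pmod2$.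
   Context: $(k)_\alpha=k(k+1)\cdots(k+\alpha-1)$; $\zeta(s)$ is the Riemann zeta value and $\zeta(s,s')=\sum_{k_1>k_2\ge1}k_1^{-s}k_2^{-s'}$. *)

theory Defs
  imports "HOL-Analysis.Analysis"
begin

text \<open>Only used at arguments at least 2: a divergent \<open>infsum\<close> would have the value 0.\<close>

definition zeta1 :: "nat \<Rightarrow> real" where
  "zeta1 s = (\<Sum>\<^sub>\<infinity>k\<in>{1::nat..}. 1 / real k ^ s)"

definition zeta2 :: "nat \<Rightarrow> nat \<Rightarrow> real" where
  "zeta2 s s' = (\<Sum>\<^sub>\<infinity>(k1, k2)\<in>{(k1::nat, k2::nat). k1 > k2 \<and> k2 \<ge> 1}.
                   1 / (real k1 ^ s * real k2 ^ s'))"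

text \<open>The term uses \<open>0 ^ 0 = 1\<close> when \<open>k1 = k2\<close> and \<open>r = f = 0\<close>.\<close>

definition double_series_term ::
    "nat \<Rightarrow> nat \<Rightarrow> nat \<Rightarrow> nat \<Rightarrow> nat \<Rightarrow> nat \<times> nat \<Rightarrow> real" where
  "double_series_term A n r e f = (\<lambda>(k1, k2).
     (real k1 + real k2 + real n + real r) ^ e * (real k1 - real k2 + real r) ^ f /
     (pochhammer (real k1 + real r) (n + 1) ^ A * pochhammer (real k2) (n + 1) ^ A))"

definition double_series_index :: "(nat \<times> nat) set" where
  "double_series_index = {(k1, k2). k1 \<ge> k2 \<and> k2 \<ge> 1}"

lemma vector_space_rat_real: "vector_space (\<lambda>(q::rat) (x::real). of_rat q * x)"
  by unfold_locales (simp_all add: of_rat_add of_rat_mult algebra_simps)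

abbreviation rat_span :: "real set \<Rightarrow> real set" where
  "rat_span \<equiv> module.span (\<lambda>(q::rat) (x::real). of_rat q * x)"

end

(* With x = k1 + r and y = k2 the numerator is homogeneous of degree e + f in x + n/2 and y + n/2,
   so the series is a combination of double sums of F(x) G(y) with F and G of the form
   (x + n/2)^a / (x)_{n+1}^A. The partial fraction expansion of F has zero residue sum, hence
   F(x) = sum_{2 <= s <= A} P_s / x^s + U(x + 1) - U(x), where P_s is a sum of coefficients and the
   poles of U lie in {0, -1, ..., -(n - 1)}; the reflection x -> -n - x kills P_s for one parity
   of s. The differences telescope and leave single sums of partial fractions, which are
   combinations of 1 and zeta values; the poles of the two factors in these sums are disjoint when
   r >= n + 1, which keeps the pole order at most A instead of 2A. The remaining products
   P_s Q_t x^{-s} y^{-t} give the double zeta values, with convergent exponents only. The swap of x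
   and y multiplies their coefficients by (-1)^f, and the parity of P_s leaves only s + t = e + f mod 2. *)

theory Submission
  imports Defs "HOL-Real_Asymp.Real_Asymp"
begin

text \<open>The obstacle is that a single partial fraction 1/(x+i) has a divergent sum, so the
  factors cannot be summed pole by pole. The hypothesis on e + f gives a + 2 <= A(n+1) for every
  exponent a <= e + f, hence x F(x) tends to 0 for each factor separately. Its simple-pole
  coefficients then cancel and F is O(x^-2), so every double sum converges absolutely and may be
  rearranged. Symmetry and parity are not read off from unique expansions. Partial fractions and the
  expansion of the numerator are only known to exist; averaging each over its symmetry gives
  coefficients that are symmetric by construction. With N = e + f, the coefficient of zeta(s,t) is
  the sum over a of \<open>m a * (P a s * P (N - a) t)\<close>. Reindexing a -> N - a produces the
  sign (-1)^f because one family \<open>P\<close> serves both variables. \<open>P a s\<close>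
  vanishes unless s + a + A(n+1) is even; adding this condition for a and for N - a makes A(n+1)
  drop out.\<close>

interpretation rat_real: vector_space "\<lambda>(q::rat) (x::real). of_rat q * x"
  by (rule vector_space_rat_real)

section \<open>Partial fractions with rational coefficients\<close>

definition pf :: "nat set \<Rightarrow> nat \<Rightarrow> (nat \<Rightarrow> nat \<Rightarrow> rat) \<Rightarrow> real \<Rightarrow> real" where
  "pf I B p x = (\<Sum>i\<in>I. \<Sum>s=1..B. of_rat (p i s) / (x + real i) ^ s)"

text \<open>Rational coefficients carry the arithmetic of the theorem. There is no polynomial part,
  so such a function vanishes at infinity. Equality is demanded only off the poles, where the
  convention x/0 = 0 cannot interfere.\<close>

definition pfrac :: "nat set \<Rightarrow> nat \<Rightarrow> (real \<Rightarrow> real) \<Rightarrow> bool" where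
  "pfrac I B F \<longleftrightarrow> (\<exists>p. \<forall>x. (\<forall>i\<in>I. x + real i \<noteq> 0) \<longrightarrow> F x = pf I B p x)"

lemma pfracI:
  assumes "\<And>x. (\<And>i. i \<in> I \<Longrightarrow> x + real i \<noteq> 0) \<Longrightarrow> F x = pf I B p x"
  shows "pfrac I B F"
  using assms unfolding pfrac_def by blast

lemma pfracE:
  assumes "pfrac I B F"
  obtains p where "\<And>x. (\<And>i. i \<in> I \<Longrightarrow> x + real i \<noteq> 0) \<Longrightarrow> F x = pf I B p x"
  using assms unfolding pfrac_def by blast

lemma pfrac_cong:
  assumes "pfrac I B F" "\<And>x. (\<And>i. i \<in> I \<Longrightarrow> x + real i \<noteq> 0) \<Longrightarrow> G x = F x"
  shows "pfrac I B G"
  using assms unfolding pfrac_def by metis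

lemma pfrac_zero: "pfrac I B (\<lambda>x. 0)"
  by (rule pfracI[where p = "\<lambda>_ _. 0"]) (simp add: pf_def)

lemma pfrac_add:
  assumes "pfrac I B F" "pfrac I B G"
  shows "pfrac I B (\<lambda>x. F x + G x)"
proof -
  obtain p where p: "\<And>x. (\<And>i. i \<in> I \<Longrightarrow> x + real i \<noteq> 0) \<Longrightarrow> F x = pf I B p x"
    using assms(1) by (rule pfracE) auto
  obtain q where q: "\<And>x. (\<And>i. i \<in> I \<Longrightarrow> x + real i \<noteq> 0) \<Longrightarrow> G x = pf I B q x"
    using assms(2) by (rule pfracE) auto
  show ?thesis
    by (rule pfracI[where p = "\<lambda>i s. p i s + q i s"])
      (simp add: p q pf_def of_rat_add add_divide_distrib sum.distrib)
qed

lemma pfrac_scale: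
  assumes "pfrac I B F"
  shows "pfrac I B (\<lambda>x. of_rat c * F x)"
proof -
  obtain p where p: "\<And>x. (\<And>i. i \<in> I \<Longrightarrow> x + real i \<noteq> 0) \<Longrightarrow> F x = pf I B p x"
    using assms(1) by (rule pfracE) auto
  show ?thesis
    by (rule pfracI[where p = "\<lambda>i s. c * p i s"])
      (simp add: p pf_def of_rat_mult sum_distrib_left)
qed

lemma pfrac_sum:
  assumes "\<And>k. k \<in> K \<Longrightarrow> pfrac I B (F k)"
  shows "pfrac I B (\<lambda>x. \<Sum>k\<in>K. F k x)"
  using assms
  by (induction K rule: infinite_finite_induct) (auto intro: pfrac_add simp: pfrac_zero)

lemma pf_single:
  assumes "finite I" "i \<in> I" "1 \<le> s" "s \<le> B"
  shows "pf I B (\<lambda>j t. if j = i \<and> t = s then c else 0) x = of_rat c / (x + real i) ^ s"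
proof -
  have "(\<Sum>t=1..B. of_rat (if j = i \<and> t = s then c else 0) / (x + real j) ^ t)
      = (if j = i then of_rat c / (x + real j) ^ s else 0)" for j
  proof -
    have "(\<Sum>t=1..B. of_rat (if j = i \<and> t = s then c else 0) / (x + real j) ^ t)
      = (\<Sum>t=1..B. if t = s then (if j = i then of_rat c / (x + real j) ^ t else 0) else 0)"
      by (rule sum.cong) auto
    then show ?thesis using assms by simp
  qed
  then show ?thesis
    using assms by (simp add: pf_def)
qed

lemma pfrac_basis:
  assumes "finite I" "i \<in> I" "1 \<le> s" "s \<le> B"
  shows "pfrac I B (\<lambda>x. 1 / (x + real i) ^ s)"
  by (rule pfracI[where p = "\<lambda>j t. if j = i \<and> t = s then 1 else 0"])
    (use pf_single[OF assms, of 1] in simp)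

text \<open>By linearity a product is treated one basis fraction at a time. \<open>G\<close> is an
  arbitrary function: G = 1 enlarges pole set and order, and two applications give products.\<close>

lemma pfrac_from_basis:
  assumes "pfrac I B F" "\<And>i s. i \<in> I \<Longrightarrow> 1 \<le> s \<Longrightarrow> s \<le> B \<Longrightarrow> pfrac J C (\<lambda>x. 1 / (x + real i) ^ s * G x)"
    and "I \<subseteq> J"
  shows "pfrac J C (\<lambda>x. F x * G x)"
proof -
  obtain p where p: "\<And>x. (\<And>i. i \<in> I \<Longrightarrow> x + real i \<noteq> 0) \<Longrightarrow> F x = pf I B p x"
    using assms(1) by (rule pfracE) auto
  have "pfrac J C (\<lambda>x. \<Sum>i\<in>I. \<Sum>s=1..B. of_rat (p i s) * (1 / (x + real i) ^ s * G x))"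
    by (intro pfrac_sum pfrac_scale assms) auto
  then show ?thesis
  proof (rule pfrac_cong)
    fix x :: real assume "\<And>i. i \<in> J \<Longrightarrow> x + real i \<noteq> 0"
    then have "F x = pf I B p x"
      using assms(3) by (intro p) auto
    then show "F x * G x = (\<Sum>i\<in>I. \<Sum>s=1..B. of_rat (p i s) * (1 / (x + real i) ^ s * G x))"
      by (simp add: pf_def sum_distrib_right)
  qed
qed

lemma pfrac_mono:
  assumes "pfrac I B F" "I \<subseteq> J" "finite J" "B \<le> C"
  shows "pfrac J C F"
proof -
  have "pfrac J C (\<lambda>x. F x * 1)"
    by (rule pfrac_from_basis[OF assms(1) _ assms(2)]) (use assms in \<open>auto intro!: pfrac_basis\<close>)
  then show ?thesis by simp
qed

lemma pfrac_mult_basis: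
  assumes "finite I" "i \<in> I" "j \<in> I" "i \<noteq> j" "s \<le> B" "t \<le> B" "0 < s + t"
  shows "pfrac I B (\<lambda>x. 1 / (x + real i) ^ s * (1 / (x + real j) ^ t))"
  using assms(5-7)
proof (induction "s + t" arbitrary: s t rule: less_induct)
  case less
  consider "s = 0" | "t = 0" | s' t' where "s = Suc s'" "t = Suc t'"
    using not0_implies_Suc by blast
  then show ?case
  proof cases
    case 1
    with less.prems show ?thesis using pfrac_basis[OF assms(1,3), of t B] by simp
  next
    case 2
    with less.prems show ?thesis using pfrac_basis[OF assms(1,2), of s B] by simp
  next
    case 3
    let ?c = "1 / (of_nat j - of_nat i) :: rat"
    have 1: "pfrac I B (\<lambda>x. 1 / (x + real i) ^ s * (1 / (x + real j) ^ t'))"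
      using 3 less.prems by (intro less.hyps) auto
    have 2: "pfrac I B (\<lambda>x. 1 / (x + real i) ^ s' * (1 / (x + real j) ^ t))"
      using 3 less.prems by (intro less.hyps) auto
    show ?thesis
    proof (rule pfrac_cong[OF pfrac_add[OF pfrac_scale[OF 1, of ?c] pfrac_scale[OF 2, of "- ?c"]]])
      fix x :: real assume x: "\<And>i. i \<in> I \<Longrightarrow> x + real i \<noteq> 0"
      have nz: "real j - real i \<noteq> 0" using assms(4) by simp
      have *: "1 / ((u * U) * (v * W)) = 1 / (v - u) * (1 / ((u * U) * W)) - 1 / (v - u) * (1 / (U * (v * W)))"
        if "u \<noteq> 0" "v \<noteq> 0" "U \<noteq> 0" "W \<noteq> 0" "v - u \<noteq> 0" for u v U W :: real
        using that by (simp add: divide_simps)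
      have e: "of_rat ?c = 1 / ((x + real j) - (x + real i))"
        by (simp add: of_rat_divide of_rat_diff)
      show "1 / (x + real i) ^ s * (1 / (x + real j) ^ t) =
         of_rat ?c * (1 / (x + real i) ^ s * (1 / (x + real j) ^ t')) +
         of_rat (- ?c) * (1 / (x + real i) ^ s' * (1 / (x + real j) ^ t))"
        unfolding of_rat_minus e
        using *[of "x + real i" "x + real j" "(x + real i) ^ s'" "(x + real j) ^ t'"] x assms(2,3) nz
        by (simp add: 3)
    qed
  qed
qed

text \<open>Orders add only at a common pole. The last hypothesis therefore asks for disjoint pole
  sets or for room for \<open>B + B'\<close>; it becomes the choice between A and 2A.\<close>

lemma pfrac_mult:
  assumes "pfrac I B F" "pfrac J B' G" "finite I" "finite J" "B \<le> C" "B' \<le> C"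
    and "I \<inter> J = {} \<or> B + B' \<le> C"
  shows "pfrac (I \<union> J) C (\<lambda>x. F x * G x)"
proof (rule pfrac_from_basis[OF assms(1)])
  fix i s assume is': "i \<in> I" "1 \<le> s" "s \<le> B"
  have "pfrac (I \<union> J) C (\<lambda>x. G x * (1 / (x + real i) ^ s))"
  proof (rule pfrac_from_basis[OF assms(2)])
    fix j t assume jt: "j \<in> J" "1 \<le> t" "t \<le> B'"
    show "pfrac (I \<union> J) C (\<lambda>x. 1 / (x + real j) ^ t * (1 / (x + real i) ^ s))"
    proof (cases "i = j")
      case True
      then have "pfrac (I \<union> J) C (\<lambda>x. 1 / (x + real i) ^ (t + s))"
        using is' jt assms by (intro pfrac_basis) auto
      then show ?thesis using True by (simp add: power_add)
    next
      case False
      then show ?thesis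
        using is' jt assms by (intro pfrac_mult_basis) auto
    qed
  qed auto
  then show "pfrac (I \<union> J) C (\<lambda>x. 1 / (x + real i) ^ s * G x)"
    by (simp add: mult.commute)
qed auto

lemma pfrac_shift:
  assumes "pfrac I B F"
  shows "pfrac ((\<lambda>i. i + r) ` I) B (\<lambda>x. F (x + real r))"
proof -
  obtain p where p: "\<And>x. (\<And>i. i \<in> I \<Longrightarrow> x + real i \<noteq> 0) \<Longrightarrow> F x = pf I B p x"
    using assms(1) by (rule pfracE) auto
  show ?thesis
  proof (rule pfracI[where p = "\<lambda>i s. p (i - r) s"])
    fix x :: real assume x: "\<And>i. i \<in> (\<lambda>i. i + r) ` I \<Longrightarrow> x + real i \<noteq> 0"
    have "F (x + real r) = pf I B p (x + real r)"
      using x by (intro p) (force simp: algebra_simps)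
    also have "\<dots> = pf ((\<lambda>i. i + r) ` I) B (\<lambda>i s. p (i - r) s) x"
      unfolding pf_def by (subst sum.reindex) (auto simp: algebra_simps intro: inj_onI)
    finally show "F (x + real r) = pf ((\<lambda>i. i + r) ` I) B (\<lambda>i s. p (i - r) s) x" .
  qed
qed

section \<open>Behaviour at infinity and telescoping of partial fractions\<close>

lemma pf_tendsto_0: "(pf I B p \<longlongrightarrow> 0) at_top"
proof -
  have "((\<lambda>x. of_rat (p i s) / (x + real i) ^ s) \<longlongrightarrow> 0) at_top" if "1 \<le> s" for i s
  proof -
    have "filterlim (\<lambda>x::real. (x + real i) ^ s) at_top at_top"
      using that
      by (intro filterlim_pow_at_top filterlim_tendsto_add_at_top[OF tendsto_const filterlim_ident, of "real i", unfolded add.commute[of "real i"]]) auto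
    then show ?thesis
      by (intro tendsto_divide_0[OF tendsto_const] filterlim_at_top_imp_at_infinity)
  qed
  then show ?thesis
    unfolding pf_def by (intro tendsto_null_sum) auto
qed

lemma pfrac_tendsto_0:
  assumes "pfrac I B F"
  shows "(F \<longlongrightarrow> 0) at_top"
proof -
  obtain p where p: "\<And>x. (\<And>i. i \<in> I \<Longrightarrow> x + real i \<noteq> 0) \<Longrightarrow> F x = pf I B p x"
    using assms(1) by (rule pfracE) auto
  have "\<forall>\<^sub>F x in at_top. pf I B p x = F x"
    using eventually_gt_at_top[of "0::real"]
    by eventually_elim (rule p[symmetric], linarith)
  then show ?thesis
    using pf_tendsto_0 by (rule Lim_transform_eventually[rotated])
qed

text \<open>Each summand is x/(x+i), which tends to 1, times p/(x+i)^(s-1), which tends to 0 unless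
  s = 1. Only the simple poles survive.\<close>

lemma x_times_pf_tendsto:
  assumes "1 \<le> B"
  shows "((\<lambda>x. x * pf I B p x) \<longlongrightarrow> (\<Sum>i\<in>I. of_rat (p i 1))) at_top"
proof -
  have 1: "((\<lambda>x. x / (x + real i)) \<longlongrightarrow> 1) at_top" for i
    by real_asymp
  have "((\<lambda>x. \<Sum>i\<in>I. \<Sum>s=1..B. (x / (x + real i)) * (of_rat (p i s) / (x + real i) ^ (s - 1))) \<longlongrightarrow>
     (\<Sum>i\<in>I. \<Sum>s=1..B. 1 * (if s = 1 then of_rat (p i 1) else 0))) at_top"
  proof (intro tendsto_sum tendsto_mult 1)
    fix i s assume "s \<in> {1..B}"
    show "((\<lambda>x. of_rat (p i s) / (x + real i) ^ (s - 1)) \<longlongrightarrow> (if s = 1 then of_rat (p i 1) else 0)) at_top"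
    proof (cases "s = 1")
      case False
      have "((\<lambda>x. pf {i} (s - 1) (\<lambda>j t. if j = i \<and> t = s - 1 then p i s else 0) x) \<longlongrightarrow> 0) at_top"
        by (rule pf_tendsto_0)
      moreover have "pf {i} (s - 1) (\<lambda>j t. if j = i \<and> t = s - 1 then p i s else 0) x = of_rat (p i s) / (x + real i) ^ (s - 1)" for x
        using False \<open>s \<in> {1..B}\<close> by (intro pf_single) auto
      ultimately show ?thesis using False by simp
    qed simp
  qed
  moreover have "(\<Sum>i\<in>I. \<Sum>s=1..B. 1 * (if s = 1 then of_rat (p i 1) else 0)) = (\<Sum>i\<in>I. of_rat (p i 1) :: real)"
    using assms by (intro sum.cong refl) simp
  moreover have "\<forall>\<^sub>F x in at_top. (\<Sum>i\<in>I. \<Sum>s=1..B. (x / (x + real i)) * (of_rat (p i s) / (x + real i) ^ (s - 1))) = x * pf I B p x"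
    using eventually_gt_at_top[of "0::real"]
  proof eventually_elim
    case (elim x)
    have "(x / (x + real i)) * (of_rat (p i s) / (x + real i) ^ (s - 1)) = x * (of_rat (p i s) / (x + real i) ^ s)"
      if "1 \<le> s" for i s
      using that by (cases s) auto
    then show ?case
      unfolding pf_def sum_distrib_left by (intro sum.cong refl) auto
  qed
  ultimately show ?thesis
    using Lim_transform_eventually by fastforce
qed

text \<open>Two limits of x F(x) agree over the reals; injectivity of \<open>of_rat\<close> brings
  the identity back to the rational coefficients.\<close>

lemma residue_sum_0:
  assumes "\<And>x. (\<And>i. i \<in> I \<Longrightarrow> x + real i \<noteq> 0) \<Longrightarrow> F x = pf I B p x"
    and "((\<lambda>x. x * F x) \<longlongrightarrow> 0) at_top" "1 \<le> B"
  shows "(\<Sum>i\<in>I. p i 1) = 0"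
proof -
  have "\<forall>\<^sub>F x in at_top. x * F x = x * pf I B p x"
    using eventually_gt_at_top[of "0::real"]
  proof eventually_elim
    case (elim x)
    have "F x = pf I B p x" using elim by (intro assms(1)) linarith
    then show ?case by simp
  qed
  then have "((\<lambda>x. x * pf I B p x) \<longlongrightarrow> 0) at_top"
    using assms(2) Lim_transform_eventually by fastforce
  then have "(\<Sum>i\<in>I. of_rat (p i 1)) = (0::real)"
    using x_times_pf_tendsto[OF assms(3)] tendsto_unique trivial_limit_at_top_linorder by blast
  then have "of_rat (\<Sum>i\<in>I. p i 1) = (0::real)"
    by (simp add: of_rat_sum)
  then show ?thesis by simp
qed

text \<open>As the residues cancel, 1/x can be subtracted from every simple fraction at no cost, and
  1/(x+i) - 1/x is O(x^-2). The factor i + 1 in the constant serves both cases: i for simple poles,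
  1 for higher order.\<close>

lemma pf_bound:
  assumes "(\<Sum>i\<in>I. p i 1) = 0" "1 \<le> B"
  shows "\<exists>C. \<forall>x\<ge>1. \<bar>pf I B p x\<bar> \<le> C / x\<^sup>2"
proof (intro exI allI impI)
  fix x :: real assume x: "1 \<le> x"
  define c where "c i s = (of_rat (p i s) :: real)" for i s
  have z: "(\<Sum>i\<in>I. c i 1) = 0"
    using assms(1) unfolding c_def by (metis of_rat_0 of_rat_sum)
  have "(\<Sum>i\<in>I. \<Sum>s=1..B. c i s * (if s = 1 then 1 / x else 0)) = (\<Sum>i\<in>I. c i 1 / x)"
  proof (intro sum.cong refl)
    fix i
    have "(\<Sum>s=1..B. c i s * (if s = 1 then 1 / x else 0)) = (\<Sum>s=1..B. if s = 1 then c i s / x else 0)"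
      by (intro sum.cong refl) auto
    then show "(\<Sum>s=1..B. c i s * (if s = 1 then 1 / x else 0)) = c i 1 / x"
      using assms(2) by simp
  qed
  also have "\<dots> = 0" using z by (simp flip: sum_divide_distrib)
  finally have "pf I B p x = (\<Sum>i\<in>I. \<Sum>s=1..B. c i s * (1 / (x + real i) ^ s - (if s = 1 then 1 / x else 0)))"
    by (simp add: pf_def c_def right_diff_distrib sum_subtractf)
  also have "\<bar>\<dots>\<bar> \<le> (\<Sum>i\<in>I. \<Sum>s=1..B. \<bar>c i s\<bar> * (real i + 1) / x\<^sup>2)"
  proof (intro order.trans[OF sum_abs] sum_mono)
    fix i s assume s: "s \<in> {1..B}"
    have "\<bar>1 / (x + real i) ^ s - (if s = 1 then 1 / x else 0)\<bar> \<le> (real i + 1) / x\<^sup>2"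
    proof (cases "s = 1")
      case True
      have "1 / (x + real i) - 1 / x = - (real i / (x * (x + real i)))"
        using x by (simp add: field_simps)
      then have "\<bar>1 / (x + real i) - 1 / x\<bar> = real i / (x * (x + real i))"
        using x by simp
      also have "\<dots> \<le> (real i + 1) / x\<^sup>2"
        using x by (intro frac_le) (auto simp: power2_eq_square)
      finally show ?thesis using True by simp
    next
      case False
      have "x\<^sup>2 \<le> x ^ s" using False s x by (intro power_increasing) auto
      also have "\<dots> \<le> (x + real i) ^ s" using x by (intro power_mono) auto
      finally have "1 / (x + real i) ^ s \<le> (real i + 1) / x\<^sup>2"
        using x by (intro frac_le) auto
      then show ?thesis using False x by simp
    qed
    then have "\<bar>c i s\<bar> * \<bar>1 / (x + real i) ^ s - (if s = 1 then 1 / x else 0)\<bar> \<le> \<bar>c i s\<bar> * ((real i + 1) / x\<^sup>2)"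
      by (rule mult_left_mono) simp
    then show "\<bar>c i s * (1 / (x + real i) ^ s - (if s = 1 then 1 / x else 0))\<bar> \<le> \<bar>c i s\<bar> * (real i + 1) / x\<^sup>2"
      by (simp add: abs_mult)
  qed
  finally show "\<bar>pf I B p x\<bar> \<le> (\<Sum>i\<in>I. \<Sum>s=1..B. \<bar>of_rat (p i s)\<bar> * (real i + 1)) / x\<^sup>2"
    unfolding c_def by (simp add: sum_divide_distrib)
qed

text \<open>Since \<open>1 / (x + i)\<^sup>s - 1 / x\<^sup>s\<close> telescopes, only the coefficient sums survive up to a difference.\<close>

lemma pf_telescope:
  assumes "(\<Sum>i\<le>n. p i 1) = 0" "1 \<le> B"
  shows "\<exists>U. pfrac {..<n} B U \<and>
    (\<forall>x>0. pf {..n} B p x = (\<Sum>s=2..B. of_rat (\<Sum>i\<le>n. p i s) / x ^ s) + (U (x + 1) - U x))"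
proof (intro exI conjI allI impI)
  \<comment> \<open>The forward difference of the sum of 1/(x+h)^s over h < i is 1/(x+i)^s - 1/x^s.
    Since i <= n, the poles of this primitive stop at h = n - 1, one short of the original
    set.\<close>
  let ?U = "\<lambda>x. \<Sum>i\<le>n. \<Sum>s=1..B. of_rat (p i s) * (\<Sum>h<i. 1 / (x + real h) ^ s)"
  show "pfrac {..<n} B ?U"
    by (intro pfrac_sum pfrac_scale pfrac_basis) auto
  fix x :: real assume x: "0 < x"
  have tel: "(\<Sum>h<i. 1 / (x + 1 + real h) ^ s) - (\<Sum>h<i. 1 / (x + real h) ^ s) = 1 / (x + real i) ^ s - 1 / x ^ s" for i s
    by (induction i) (auto simp: algebra_simps)
  have "?U (x + 1) - ?U x = (\<Sum>i\<le>n. \<Sum>s=1..B. of_rat (p i s) *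
      ((\<Sum>h<i. 1 / (x + 1 + real h) ^ s) - (\<Sum>h<i. 1 / (x + real h) ^ s)))"
    by (simp only: sum_subtractf right_diff_distrib)
  also have "\<dots> = (\<Sum>i\<le>n. \<Sum>s=1..B. of_rat (p i s) * (1 / (x + real i) ^ s - 1 / x ^ s))"
    by (simp only: tel)
  also have "\<dots> = pf {..n} B p x - (\<Sum>i\<le>n. \<Sum>s=1..B. of_rat (p i s) / x ^ s)"
    by (simp add: pf_def right_diff_distrib sum_subtractf)
  also have "(\<Sum>i\<le>n. \<Sum>s=1..B. of_rat (p i s) / x ^ s) = (\<Sum>s=1..B. of_rat (\<Sum>i\<le>n. p i s) / x ^ s)"
    by (subst sum.swap) (simp add: of_rat_sum sum_divide_distrib)
  \<comment> \<open>The term s = 1 carries the residue sum, which is 0.\<close>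
  also have "\<dots> = (\<Sum>s=2..B. of_rat (\<Sum>i\<le>n. p i s) / x ^ s)"
    using assms by (subst sum.atLeast_Suc_atMost) (auto simp: numeral_2_eq_2)
  finally show "pf {..n} B p x = (\<Sum>s=2..B. of_rat (\<Sum>i\<le>n. p i s) / x ^ s) + (?U (x + 1) - ?U x)"
    by simp
qed

lemma pfrac_rational_value:
  assumes "pfrac I B F" "1 \<le> m"
  shows "\<exists>q. F (real m) = of_rat q"
proof -
  obtain p where p: "\<And>x. (\<And>i. i \<in> I \<Longrightarrow> x + real i \<noteq> 0) \<Longrightarrow> F x = pf I B p x"
    using assms(1) by (rule pfracE) auto
  have "F (real m) = pf I B p (real m)"
    using assms(2) by (intro p) linarith
  also have "\<dots> = of_rat (\<Sum>i\<in>I. \<Sum>s=1..B. p i s / (of_nat m + of_nat i) ^ s)"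
    by (simp add: pf_def of_rat_sum of_rat_divide of_rat_power of_rat_add)
  finally show ?thesis by blast
qed

section \<open>Quadratically decaying sequences\<close>

text \<open>This decay makes products f(k1) g(k2) absolutely summable over any set of positive index
  pairs, which licenses every interchange of summations below.\<close>

definition quad :: "(nat \<Rightarrow> real) \<Rightarrow> bool" where
  "quad f \<longleftrightarrow> (\<exists>C. \<forall>k\<ge>1. \<bar>f k\<bar> \<le> C / (real k)\<^sup>2)"

lemma quadE:
  assumes "quad f"
  obtains C where "0 \<le> C" "\<And>k. 1 \<le> k \<Longrightarrow> \<bar>f k\<bar> \<le> C / (real k)\<^sup>2"
proof -
  obtain C where C: "\<And>k. 1 \<le> k \<Longrightarrow> \<bar>f k\<bar> \<le> C / (real k)\<^sup>2"
    using assms unfolding quad_def by blast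
  have "0 \<le> C" using C[of 1] by simp
  with C that show ?thesis by blast
qed

lemma quad_add:
  assumes "quad f" "quad g"
  shows "quad (\<lambda>k. f k + g k)"
proof -
  obtain C where "\<And>k. 1 \<le> k \<Longrightarrow> \<bar>f k\<bar> \<le> C / (real k)\<^sup>2" using assms(1) by (rule quadE) blast
  moreover obtain C' where "\<And>k. 1 \<le> k \<Longrightarrow> \<bar>g k\<bar> \<le> C' / (real k)\<^sup>2" using assms(2) by (rule quadE) blast
  ultimately have "\<bar>f k + g k\<bar> \<le> (C + C') / (real k)\<^sup>2" if "1 \<le> k" for k
    using that by (smt (verit) add_divide_distrib)
  then show ?thesis unfolding quad_def by blast
qed

lemma quad_scale:
  assumes "quad f"
  shows "quad (\<lambda>k. c * f k)"
proof -
  obtain C where C: "\<And>k. 1 \<le> k \<Longrightarrow> \<bar>f k\<bar> \<le> C / (real k)\<^sup>2" using assms(1) by (rule quadE) blast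
  have "\<bar>c * f k\<bar> \<le> (\<bar>c\<bar> * C) / (real k)\<^sup>2" if "1 \<le> k" for k
    using mult_left_mono[OF C[OF that], of "\<bar>c\<bar>"] by (simp add: abs_mult)
  then show ?thesis unfolding quad_def by blast
qed

lemma quad_diff: "quad f \<Longrightarrow> quad g \<Longrightarrow> quad (\<lambda>k. f k - g k)"
  using quad_add[of f "\<lambda>k. - 1 * g k"] quad_scale[of g "- 1"] by simp

lemma quad_sum:
  assumes "\<And>i. i \<in> I \<Longrightarrow> quad (f i)"
  shows "quad (\<lambda>k. \<Sum>i\<in>I. f i k)"
proof -
  have "quad (\<lambda>k. 0)" unfolding quad_def by (intro exI[of _ 0]) simp
  with assms show ?thesis
    by (induction I rule: infinite_finite_induct) (auto intro: quad_add)
qed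

lemma quad_shift:
  assumes "quad f"
  shows "quad (\<lambda>k. f (k + r))"
proof -
  obtain C where C: "0 \<le> C" "\<And>k. 1 \<le> k \<Longrightarrow> \<bar>f k\<bar> \<le> C / (real k)\<^sup>2" using assms(1) by (rule quadE) blast
  have "\<bar>f (k + r)\<bar> \<le> C / (real k)\<^sup>2" if "1 \<le> k" for k
  proof -
    have "\<bar>f (k + r)\<bar> \<le> C / (real (k + r))\<^sup>2" using that by (intro C) auto
    also have "\<dots> \<le> C / (real k)\<^sup>2" using C(1) that by (intro divide_left_mono power_mono) auto
    finally show ?thesis .
  qed
  then show ?thesis unfolding quad_def by blast
qed

lemma quad_inverse_power:
  assumes "2 \<le> s"
  shows "quad (\<lambda>k. 1 / real k ^ s)"
  unfolding quad_def
proof (intro exI allI impI)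
  fix k :: nat assume "1 \<le> k"
  then show "\<bar>1 / real k ^ s\<bar> \<le> 1 / (real k)\<^sup>2"
    using assms by (auto intro!: divide_left_mono power_increasing)
qed

lemma inverse_square_summable_on: "(\<lambda>k. 1 / (real k)\<^sup>2) summable_on {1..}"
proof -
  have "summable (\<lambda>k. 1 / (real k)\<^sup>2)"
    using inverse_power_summable[of 2, where 'a = real] by (simp add: field_simps)
  then have "(\<lambda>k. 1 / (real k)\<^sup>2) summable_on UNIV"
    by (subst summable_on_UNIV_nonneg_real_iff) auto
  then show ?thesis by (rule summable_on_subset) auto
qed

lemma quad_summable:
  assumes "quad f" "K \<subseteq> {1..}"
  shows "f summable_on K"
proof -
  obtain C where C: "\<And>k. 1 \<le> k \<Longrightarrow> \<bar>f k\<bar> \<le> C / (real k)\<^sup>2" using assms(1) by (rule quadE) blast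
  have "(\<lambda>k. C * (1 / (real k)\<^sup>2)) summable_on K"
    by (intro summable_on_cmult_right summable_on_subset[OF inverse_square_summable_on assms(2)])
  then have "(\<lambda>k. norm (f k)) summable_on K"
    by (rule Infinite_Sum.abs_summable_on_comparison_test') (use C assms(2) in auto)
  then show ?thesis by (rule Infinite_Sum.abs_summable_summable)
qed

lemma quad_mult_summable:
  assumes "quad f" "quad g" "D \<subseteq> {1..} \<times> {1..}"
  shows "(\<lambda>(k1, k2). f k1 * g k2) summable_on D"
proof -
  obtain C where C: "0 \<le> C" "\<And>k. 1 \<le> k \<Longrightarrow> \<bar>f k\<bar> \<le> C / (real k)\<^sup>2" using assms(1) by (rule quadE) blast
  obtain C' where C': "0 \<le> C'" "\<And>k. 1 \<le> k \<Longrightarrow> \<bar>g k\<bar> \<le> C' / (real k)\<^sup>2" using assms(2) by (rule quadE) blast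
  define h where "h = (\<lambda>(k1, k2). (C / (real k1)\<^sup>2) * (C' / (real k2)\<^sup>2))"
  have "h summable_on ({1..} \<times> {1..})"
  proof (rule summable_on_SigmaI)
    show "((\<lambda>y. h (x, y)) has_sum (C / (real x)\<^sup>2) * (C' * infsum (\<lambda>k. 1 / (real k)\<^sup>2) {1..})) {1..}" for x
      using has_sum_cmult_right[OF has_sum_cmult_right[OF has_sum_infsum[OF inverse_square_summable_on], of C'], of "C / (real x)\<^sup>2"]
      by (simp add: h_def)
    show "(\<lambda>x. (C / (real x)\<^sup>2) * (C' * infsum (\<lambda>k. 1 / (real k)\<^sup>2) {1..})) summable_on {1..}"
      using summable_on_cmult_left[OF summable_on_cmult_right[OF inverse_square_summable_on, of C]]
      by simp
  qed (use C C' in \<open>auto simp: h_def\<close>)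
  then have "h summable_on D" using assms(3) by (rule summable_on_subset)
  then have "(\<lambda>k. norm (case k of (k1, k2) \<Rightarrow> f k1 * g k2)) summable_on D"
  proof (rule Infinite_Sum.abs_summable_on_comparison_test')
    fix k assume "k \<in> D"
    with assms(3) obtain k1 k2 where k: "k = (k1, k2)" "1 \<le> k1" "1 \<le> k2" by auto
    have "\<bar>f k1\<bar> * \<bar>g k2\<bar> \<le> (C / (real k1)\<^sup>2) * (C' / (real k2)\<^sup>2)"
      using C C' k by (intro mult_mono) auto
    then show "norm (case k of (k1, k2) \<Rightarrow> f k1 * g k2) \<le> h k"
      by (simp add: k h_def abs_mult)
  qed
  then show ?thesis by (rule Infinite_Sum.abs_summable_summable)
qed

lemma has_sum_finite_sum:
  fixes f :: "'i \<Rightarrow> 'a \<Rightarrow> real"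
  assumes "\<And>i. i \<in> I \<Longrightarrow> (f i has_sum c i) A"
  shows "((\<lambda>x. \<Sum>i\<in>I. f i x) has_sum (\<Sum>i\<in>I. c i)) A"
  using assms
proof (induction I rule: infinite_finite_induct)
  case (insert i I)
  then have "(f i has_sum c i) A" "((\<lambda>x. \<Sum>i\<in>I. f i x) has_sum (\<Sum>i\<in>I. c i)) A" by auto
  from has_sum_add[OF this] insert.hyps show ?case by simp
qed auto

section \<open>Telescoping over half-lines and over the triangle\<close>

lemma infsum_telescope:
  fixes g :: "nat \<Rightarrow> real"
  assumes "g \<longlonglongrightarrow> 0" "(\<lambda>k. g (Suc k) - g k) summable_on {m..}"
  shows "infsum (\<lambda>k. g (Suc k) - g k) {m..} = - g m"
proof -
  have bij: "bij_betw (\<lambda>k. k + m) UNIV {m..}"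
    by (rule bij_betwI[where g = "\<lambda>k. k - m"]) auto
  have s: "(\<lambda>k. g (Suc (k + m)) - g (k + m)) summable_on UNIV"
    using assms(2) summable_on_reindex_bij_betw[OF bij, of "\<lambda>k. g (Suc k) - g k"] by simp
  \<comment> \<open>\<open>infsum\<close> is unordered; summability identifies it with the limit of
    the ordinary partial sums, which telescope.\<close>
  have "(\<lambda>k. g (Suc (k + m)) - g (k + m)) sums infsum (\<lambda>k. g (Suc (k + m)) - g (k + m)) UNIV"
    using s by (intro has_sum_imp_sums has_sum_infsum)
  moreover have "(\<lambda>k. g (Suc (k + m)) - g (k + m)) sums (0 - g (0 + m))"
    using telescope_sums[OF LIMSEQ_ignore_initial_segment[OF assms(1), of m]] by simp
  ultimately have "infsum (\<lambda>k. g (Suc (k + m)) - g (k + m)) UNIV = 0 - g (0 + m)"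
    by (rule sums_unique2)
  then show ?thesis
    using infsum_reindex_bij_betw[OF bij, of "\<lambda>k. g (Suc k) - g k"] by simp
qed

text \<open>For fixed k2 the inner sum over k1 >= k2 telescopes to -u(k2). Only the difference of
  \<open>u\<close> has to decay quadratically; \<open>u\<close> itself merely tends to 0.\<close>

lemma infsum_lower_triangle_telescope:
  fixes u :: "nat \<Rightarrow> real"
  assumes "u \<longlonglongrightarrow> 0" "quad (\<lambda>k. u (Suc k) - u k)" "quad g"
  shows "infsum (\<lambda>(k1, k2). (u (Suc k1) - u k1) * g k2) double_series_index
     = infsum (\<lambda>k. - (u k * g k)) {1..}"
proof -
  let ?f = "\<lambda>(k2, k1). (u (Suc k1) - u k1) * g k2"
  have "infsum (\<lambda>(k1, k2). (u (Suc k1) - u k1) * g k2) double_series_index = infsum ?f (SIGMA k2:{1..}. {k2..})"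
    by (rule infsum_reindex_bij_witness[of _ prod.swap prod.swap]) (auto simp: double_series_index_def)
  also have "\<dots> = infsum (\<lambda>k2. infsum (\<lambda>k1. ?f (k2, k1)) {k2..}) {1..}"
  proof (rule infsum_Sigma_banach[symmetric])
    have "(\<lambda>(k2, k1). g k2 * (u (Suc k1) - u k1)) summable_on (SIGMA k2:{1..}. {k2..})"
      by (rule quad_mult_summable) (use assms in auto)
    then show "?f summable_on (SIGMA k2:{1..}. {k2..})"
      by (simp add: mult.commute)
  qed
  also have "\<dots> = infsum (\<lambda>k. - (u k * g k)) {1..}"
  proof (rule infsum_cong)
    fix k :: nat assume "k \<in> {1..}"
    then have "(\<lambda>k. u (Suc k) - u k) summable_on {k..}"
      using assms(2) by (intro quad_summable) auto
    then show "infsum (\<lambda>k1. ?f (k, k1)) {k..} = - (u k * g k)"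
      using infsum_telescope[OF assms(1)] by (simp add: infsum_cmult_left')
  qed
  finally show ?thesis .
qed

text \<open>For fixed k1 the inner sum over 1 <= k2 <= k1 is finite, so no limit of \<open>h\<close>
  enters, but the boundary value h(1) is left behind.\<close>

lemma infsum_upper_triangle_telescope:
  fixes h :: "nat \<Rightarrow> real"
  assumes "quad f" "quad (\<lambda>k. h (Suc k) - h k)"
  shows "infsum (\<lambda>(k1, k2). f k1 * (h (Suc k2) - h k2)) double_series_index
     = infsum (\<lambda>k. f k * (h (Suc k) - h 1)) {1..}"
proof -
  let ?f = "\<lambda>(k1, k2). f k1 * (h (Suc k2) - h k2)"
  have D: "double_series_index = (SIGMA k1:{1..}. {1..k1})"
    by (auto simp: double_series_index_def)
  have "infsum ?f double_series_index = infsum (\<lambda>k1. infsum (\<lambda>k2. ?f (k1, k2)) {1..k1}) {1..}"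
    unfolding D by (intro infsum_Sigma_banach[symmetric] quad_mult_summable) (use assms in auto)
  also have "\<dots> = infsum (\<lambda>k. f k * (h (Suc k) - h 1)) {1..}"
  proof (rule infsum_cong)
    fix k :: nat assume "k \<in> {1..}"
    then have "(\<Sum>j=1..k. h (Suc j) - h j) = h (Suc k) - h 1"
      using sum_Suc_diff[of 1 k h] by simp
    then show "infsum (\<lambda>k2. ?f (k, k2)) {1..k} = f k * (h (Suc k) - h 1)"
      by (simp flip: sum_distrib_left)
  qed
  finally show ?thesis .
qed

definition strict_index :: "(nat \<times> nat) set" where
  "strict_index = {(k1, k2). k1 > k2 \<and> k2 \<ge> 1}"

text \<open>Raising k1 by one turns k1 >= k2 into k1 > k2. Once the diagonal is split off, this
  compares the sums for consecutive shifts r.\<close>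

lemma infsum_triangle_shift:
  fixes f g :: "nat \<Rightarrow> real"
  shows "infsum (\<lambda>(k1, k2). f (Suc k1) * g k2) double_series_index
    = infsum (\<lambda>(k1, k2). f k1 * g k2) strict_index"
proof -
  have "bij_betw (\<lambda>(k1, k2). (Suc k1, k2)) double_series_index strict_index"
    by (rule bij_betwI[where g = "\<lambda>(k1, k2). (k1 - 1, k2)"])
      (auto simp: double_series_index_def strict_index_def)
  from infsum_reindex_bij_betw[OF this, of "\<lambda>(k1, k2). f k1 * g k2"]
  show ?thesis by (simp add: case_prod_unfold)
qed

lemma infsum_triangle_split:
  fixes f g :: "nat \<Rightarrow> real"
  assumes "quad f" "quad g"
  shows "infsum (\<lambda>(k1, k2). f k1 * g k2) double_series_index
    = infsum (\<lambda>(k1, k2). f k1 * g k2) strict_index + infsum (\<lambda>k. f k * g k) {1..}"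
proof -
  let ?E = "(\<lambda>k. (k, k)) ` {1::nat..}"
  have "double_series_index = strict_index \<union> ?E"
    by (auto simp: double_series_index_def strict_index_def)
  moreover have "infsum (\<lambda>(k1, k2). f k1 * g k2) (strict_index \<union> ?E)
     = infsum (\<lambda>(k1, k2). f k1 * g k2) strict_index + infsum (\<lambda>(k1, k2). f k1 * g k2) ?E"
    by (intro infsum_Un_disjoint quad_mult_summable assms) (auto simp: strict_index_def)
  moreover have "infsum (\<lambda>(k1, k2). f k1 * g k2) ?E = infsum (\<lambda>k. f k * g k) {1..}"
    by (subst infsum_reindex) (auto intro: inj_onI simp: o_def)
  ultimately show ?thesis by simp
qed

section \<open>Sums of partial fractions\<close>

definition zspan :: "nat \<Rightarrow> real set" where
  "zspan S = rat_span ({1} \<union> {zeta1 s | s. 2 \<le> s \<and> s \<le> S})"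

lemma of_rat_in_zspan: "of_rat q \<in> zspan S"
  using rat_real.span_scale[OF rat_real.span_base, of 1 "{1} \<union> {zeta1 s | s. 2 \<le> s \<and> s \<le> S}" q]
  by (simp add: zspan_def)

lemma zeta1_in_zspan: "2 \<le> s \<Longrightarrow> s \<le> S \<Longrightarrow> zeta1 s \<in> zspan S"
  unfolding zspan_def by (rule rat_real.span_base) auto

lemmas zspan_add = rat_real.span_add[of _ "{1} \<union> {zeta1 s | s. 2 \<le> s \<and> s \<le> S}" for S, folded zspan_def]
lemmas zspan_diff = rat_real.span_diff[of _ "{1} \<union> {zeta1 s | s. 2 \<le> s \<and> s \<le> S}" for S, folded zspan_def]
lemmas zspan_scale = rat_real.span_scale[of _ "{1} \<union> {zeta1 s | s. 2 \<le> s \<and> s \<le> S}" for S, folded zspan_def]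
lemmas zspan_sum = rat_real.span_sum[of _ _ "{1} \<union> {zeta1 s | s. 2 \<le> s \<and> s \<le> S}" for S, folded zspan_def]
lemmas zspan_neg = rat_real.span_neg[of _ "{1} \<union> {zeta1 s | s. 2 \<le> s \<and> s \<le> S}" for S, folded zspan_def]

lemma tendsto_real_sequentially:
  assumes "(F \<longlongrightarrow> l) at_top"
  shows "(\<lambda>k. F (real (k + r))) \<longlonglongrightarrow> l"
  using LIMSEQ_ignore_initial_segment[OF filterlim_compose[OF assms filterlim_real_sequentially]] by simp

text \<open>Once the pole set is enlarged to an initial segment, F is a combination of x^(-s) with 2
  <= s <= B plus a difference of some U. The powers sum to zeta values and the difference to -U(1),
  a rational number. The pole order thus bounds the zeta arguments.\<close>

lemma pfrac_infsum:
  assumes F: "pfrac I B F" and "finite I" "1 \<le> B" and lim: "((\<lambda>x. x * F x) \<longlongrightarrow> 0) at_top"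
  shows "quad (\<lambda>k. F (real k))" and "infsum (\<lambda>k. F (real k)) {1..} \<in> zspan B"
proof -
  obtain n where "\<And>i. i \<in> I \<Longrightarrow> i \<le> n"
    using \<open>finite I\<close> by (metis Max_ge)
  then have "pfrac {..n} B F"
    by (intro pfrac_mono[OF F]) auto
  then obtain p where p: "\<And>x. (\<And>i. i \<in> {..n} \<Longrightarrow> x + real i \<noteq> 0) \<Longrightarrow> F x = pf {..n} B p x"
    by (rule pfracE) auto
  have z: "(\<Sum>i\<le>n. p i 1) = 0"
    using residue_sum_0[OF p lim] \<open>1 \<le> B\<close> by simp
  have pos: "F x = pf {..n} B p x" if "0 < x" for x
    using that by (intro p) linarith
  obtain C where "\<And>x. 1 \<le> x \<Longrightarrow> \<bar>pf {..n} B p x\<bar> \<le> C / x\<^sup>2"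
    using pf_bound[where p = p, OF z \<open>1 \<le> B\<close>] by blast
  then show quad: "quad (\<lambda>k. F (real k))"
    unfolding quad_def using pos by (intro exI[of _ C]) auto
  obtain U where U: "pfrac {..<n} B U"
    and tel: "\<forall>x>0. pf {..n} B p x = (\<Sum>s=2..B. of_rat (\<Sum>i\<le>n. p i s) / x ^ s) + (U (x + 1) - U x)"
    using pf_telescope[where p = p, OF z \<open>1 \<le> B\<close>] by blast
  have eq: "F x = (\<Sum>s=2..B. of_rat (\<Sum>i\<le>n. p i s) / x ^ s) + (U (x + 1) - U x)" if "0 < x" for x
    using pos[OF that] tel that by simp
  define \<phi> :: "nat \<Rightarrow> real" where "\<phi> k = (\<Sum>s=2..B. of_rat (\<Sum>i\<le>n. p i s) * (1 / real k ^ s))" for k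
  define u where "u k = U (real k)" for k
  have qphi: "quad \<phi>" unfolding \<phi>_def by (intro quad_sum quad_scale quad_inverse_power) auto
  have du: "u (Suc k) - u k = F (real k) - \<phi> k" if "k \<in> {1..}" for k
    using eq[of "real k"] that by (simp add: \<phi>_def u_def add.commute)
  have sdu: "(\<lambda>k. u (Suc k) - u k) summable_on {1..}"
    by (subst summable_on_cong[OF du]) (auto intro: quad_summable quad_diff[OF quad qphi])
  have "infsum (\<lambda>k. F (real k)) {1..} = infsum (\<lambda>k. \<phi> k + (u (Suc k) - u k)) {1..}"
    by (rule infsum_cong) (simp add: du)
  also have "\<dots> = infsum \<phi> {1..} + infsum (\<lambda>k. u (Suc k) - u k) {1..}"
    using sdu quad_summable[OF qphi] by (intro infsum_add) auto
  also have "infsum (\<lambda>k. u (Suc k) - u k) {1..} = - u 1"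
    using tendsto_real_sequentially[OF pfrac_tendsto_0[OF U], of 0] sdu
    by (intro infsum_telescope) (auto simp: u_def)
  also have "infsum \<phi> {1..} = (\<Sum>s=2..B. of_rat (\<Sum>i\<le>n. p i s) * zeta1 s)"
  proof -
    have "(\<phi> has_sum (\<Sum>s=2..B. of_rat (\<Sum>i\<le>n. p i s) * zeta1 s)) {1..}"
      unfolding \<phi>_def zeta1_def
      by (intro has_sum_finite_sum has_sum_cmult_right has_sum_infsum quad_summable quad_inverse_power) auto
    then show ?thesis by (rule infsumI)
  qed
  finally have "infsum (\<lambda>k. F (real k)) {1..} = (\<Sum>s=2..B. of_rat (\<Sum>i\<le>n. p i s) * zeta1 s) + - u 1" .
  moreover obtain q where "u 1 = of_rat q"
    using pfrac_rational_value[OF U, of 1] by (auto simp: u_def)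
  ultimately show "infsum (\<lambda>k. F (real k)) {1..} \<in> zspan B"
    by (auto intro!: zspan_add zspan_diff zspan_sum zspan_scale zeta1_in_zspan simp: of_rat_in_zspan)
qed

lemma quad_cong:
  assumes "quad f" "\<And>k. 1 \<le> k \<Longrightarrow> g k = f k"
  shows "quad g"
  using assms unfolding quad_def by simp

section \<open>Sums over the triangle modulo single zeta values\<close>

lemma x_inverse_power_tendsto_0:
  assumes "2 \<le> s"
  shows "((\<lambda>x::real. x * (1 / (x + real r) ^ s)) \<longlongrightarrow> 0) at_top"
proof -
  let ?p = "\<lambda>j t. if j = r \<and> t = s then 1 else 0"
  have "((\<lambda>x. x * pf {r} s ?p x) \<longlongrightarrow> (\<Sum>i\<in>{r}. of_rat (?p i 1))) at_top"
    using assms by (intro x_times_pf_tendsto) auto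
  moreover have "pf {r} s ?p x = 1 / (x + real r) ^ s" for x
    using pf_single[of "{r}" r s s 1 x] assms by simp
  ultimately show ?thesis
    using assms by simp
qed

text \<open>Increasing r by one removes a diagonal sum d(r). At r = 1 the triangle is strict and the
  sum is zeta(s,t) itself. For r >= 1 the poles 0 and -r of the diagonal term differ, so d(r) stays
  within order A; only r = 0 meets zeta(s+t), whence the extra demand there.\<close>

lemma triangle_power_sum:
  assumes "2 \<le> s" "s \<le> A" "2 \<le> t" "t \<le> A" "A \<le> S" "r = 0 \<longrightarrow> 2 * A \<le> S"
  shows "infsum (\<lambda>(k1, k2). 1 / real (k1 + r) ^ s * (1 / real k2 ^ t)) double_series_index - zeta2 s t \<in> zspan S"
proof -
  define T where "T r = infsum (\<lambda>(k1, k2). 1 / real (k1 + r) ^ s * (1 / real k2 ^ t)) double_series_index" for r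
  define d where "d r = infsum (\<lambda>k. 1 / real (k + r) ^ s * (1 / real k ^ t)) {1..}" for r
  have Suc: "T (Suc r) = T r - d r" for r
    using infsum_triangle_shift[of "\<lambda>k. 1 / real (k + r) ^ s" "\<lambda>k. 1 / real k ^ t"]
      infsum_triangle_split[OF quad_shift[OF quad_inverse_power[OF assms(1)], of r] quad_inverse_power[OF assms(3)]]
    by (simp add: T_def d_def)
  have "T 1 = zeta2 s t"
    using infsum_triangle_shift[of "\<lambda>k. 1 / real k ^ s" "\<lambda>k. 1 / real k ^ t"]
    by (simp add: T_def zeta2_def strict_index_def)
  have d0: "d 0 = zeta1 (s + t)"
    by (simp add: d_def zeta1_def power_add)
  have d: "d r \<in> zspan S" if "1 \<le> r" for r
  proof -
    let ?F = "\<lambda>x. 1 / (x + real r) ^ s * (1 / (x + real 0) ^ t)"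
    have "pfrac {r, 0} S ?F"
      using that assms by (intro pfrac_mult_basis) auto
    moreover have "((\<lambda>x. x * ?F x) \<longlongrightarrow> 0) at_top"
    proof -
      have "((\<lambda>x. pf {0} t (\<lambda>j u. if j = 0 \<and> u = t then 1 else 0) x) \<longlongrightarrow> 0) at_top"
        by (rule pf_tendsto_0)
      moreover have "pf {0} t (\<lambda>j u. if j = 0 \<and> u = t then 1 else 0) x = 1 / (x + real 0) ^ t" for x
        using pf_single[of "{0}" 0 t t 1 x] assms by simp
      ultimately have "((\<lambda>x::real. 1 / (x + real 0) ^ t) \<longlongrightarrow> 0) at_top" by simp
      from tendsto_mult[OF x_inverse_power_tendsto_0[OF assms(1), of r] this]
      show ?thesis by (simp only: mult.assoc) simp
    qed
    ultimately have "infsum (\<lambda>k. ?F (real k)) {1..} \<in> zspan S"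
      using assms by (intro pfrac_infsum(2)) auto
    then show ?thesis by (simp add: d_def)
  qed
  have "T (Suc q) - zeta2 s t \<in> zspan S" for q
  proof (induction q)
    case 0
    show ?case using \<open>T 1 = zeta2 s t\<close> of_rat_in_zspan[of 0] by simp
  next
    case (Suc q)
    have "T (Suc (Suc q)) - zeta2 s t = (T (Suc q) - zeta2 s t) - d (Suc q)"
      using \<open>\<And>r. T (Suc r) = T r - d r\<close>[of "Suc q"] by simp
    also have "\<dots> \<in> zspan S"
      by (intro zspan_diff Suc.IH d) simp
    finally show ?case .
  qed
  \<comment> \<open>The case r = 0 lies one step before the start of the induction and is reached by
    adding d(0) back.\<close>
  moreover have "T 0 - zeta2 s t = zeta1 (s + t)"
    using Suc[of 0] d0 \<open>T 1 = zeta2 s t\<close> by simp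
  moreover have "zeta1 (s + t) \<in> zspan S" if "r = 0"
    using that assms by (intro zeta1_in_zspan) auto
  ultimately have "T r - zeta2 s t \<in> zspan S"
    by (cases r) auto
  then show ?thesis by (simp add: T_def)
qed

text \<open>What the double sum needs from each factor: its poles, its decay, and a telescoped form
  without 1/x. \<open>P\<close> is constrained only at 2 <= s <= A.\<close>

definition good :: "nat \<Rightarrow> nat \<Rightarrow> (nat \<Rightarrow> rat) \<Rightarrow> (real \<Rightarrow> real) \<Rightarrow> bool" where
  "good n A P F \<longleftrightarrow> pfrac {..n} A F \<and> ((\<lambda>x. x * F x) \<longlongrightarrow> 0) at_top \<and>
    (\<exists>U. pfrac {..<n} A U \<and> (\<forall>x>0. F x = (\<Sum>s=2..A. of_rat (P s) / x ^ s) + (U (x + 1) - U x)))"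

lemma good_quad:
  assumes "good n A P F" "1 \<le> A"
  shows "quad (\<lambda>k. F (real k))"
  using assms by (intro pfrac_infsum(1)[of "{..n}" A]) (auto simp: good_def)

text \<open>Write f = \<phi> + Du and g = \<psi> + Dh with forward differences D. The splitting fg =
  (Du) g + \<phi> (Dh) + \<phi> \<psi> keeps g whole in the first term, so no product of two
  differences arises. The first two terms telescope to single sums, the third gives the double zeta
  values.\<close>

lemma good_double_sum:
  assumes F: "good n A P F" and G: "good n A Q G" and A: "1 \<le> A" "A \<le> S"
    and S: "n + 1 \<le> r \<or> 2 * A \<le> S"
  shows "infsum (\<lambda>(k1, k2). F (real (k1 + r)) * G (real k2)) double_series_index
    - (\<Sum>s=2..A. \<Sum>t=2..A. of_rat (P s * Q t) * zeta2 s t) \<in> zspan S"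
proof -
  let ?D = double_series_index
  obtain U where U: "pfrac {..<n} A U"
    and FU: "\<And>x. x > 0 \<Longrightarrow> F x = (\<Sum>s=2..A. of_rat (P s) / x ^ s) + (U (x + 1) - U x)"
    using F unfolding good_def by blast
  obtain H where H: "pfrac {..<n} A H"
    and GH: "\<And>x. x > 0 \<Longrightarrow> G x = (\<Sum>s=2..A. of_rat (Q s) / x ^ s) + (H (x + 1) - H x)"
    using G unfolding good_def by blast
  define f where "f k = F (real (k + r))" for k
  define g where "g k = G (real k)" for k
  define u where "u k = U (real (k + r))" for k
  define h where "h k = H (real k)" for k
  define \<phi> where "\<phi> k = (\<Sum>s=2..A. of_rat (P s) * (1 / real (k + r) ^ s))" for k
  define \<psi> where "\<psi> k = (\<Sum>s=2..A. of_rat (Q s) * (1 / real k ^ s))" for k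
  have q: "quad f" "quad g" "quad \<phi>" "quad \<psi>"
  proof -
    show "quad f"
      unfolding f_def by (rule quad_shift[OF good_quad[OF F A(1)]])
    show "quad g"
      unfolding g_def by (rule good_quad[OF G A(1)])
    show "quad \<phi>"
      unfolding \<phi>_def by (rule quad_sum, rule quad_scale, rule quad_shift[OF quad_inverse_power]) simp
    show "quad \<psi>"
      unfolding \<psi>_def by (rule quad_sum, rule quad_scale, rule quad_inverse_power) simp
  qed
  have du: "u (Suc k) - u k = f k - \<phi> k" if "1 \<le> k" for k
    using FU[of "real (k + r)"] that by (simp add: f_def u_def \<phi>_def add_ac)
  have dh: "h (Suc k) - h k = g k - \<psi> k" if "1 \<le> k" for k
    using GH[of "real k"] that by (simp add: g_def h_def \<psi>_def add_ac)
  have qd: "quad (\<lambda>k. u (Suc k) - u k)" "quad (\<lambda>k. h (Suc k) - h k)"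
    by (rule quad_cong[OF quad_diff[OF q(1,3)] du]; assumption)
      (rule quad_cong[OF quad_diff[OF q(2,4)] dh]; assumption)
  have sub: "?D \<subseteq> {1..} \<times> {1..}" by (auto simp: double_series_index_def)
  have "infsum (\<lambda>(k1, k2). f k1 * g k2) ?D
     = infsum (\<lambda>k. (case k of (k1, k2) \<Rightarrow> (u (Suc k1) - u k1) * g k2) +
       ((case k of (k1, k2) \<Rightarrow> \<phi> k1 * (h (Suc k2) - h k2)) + (case k of (k1, k2) \<Rightarrow> \<phi> k1 * \<psi> k2))) ?D"
  proof (intro infsum_cong)
    fix k assume "k \<in> ?D"
    then obtain k1 k2 where k: "k = (k1, k2)" "1 \<le> k1" "1 \<le> k2"
      by (auto simp: double_series_index_def)
    show "(case k of (k1, k2) \<Rightarrow> f k1 * g k2) = (case k of (k1, k2) \<Rightarrow> (u (Suc k1) - u k1) * g k2) +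
       ((case k of (k1, k2) \<Rightarrow> \<phi> k1 * (h (Suc k2) - h k2)) + (case k of (k1, k2) \<Rightarrow> \<phi> k1 * \<psi> k2))"
      unfolding k(1) prod.case du[OF k(2)] dh[OF k(3)] by (simp add: algebra_simps)
  qed
  also have "\<dots> = infsum (\<lambda>(k1, k2). (u (Suc k1) - u k1) * g k2) ?D
      + (infsum (\<lambda>(k1, k2). \<phi> k1 * (h (Suc k2) - h k2)) ?D + infsum (\<lambda>(k1, k2). \<phi> k1 * \<psi> k2) ?D)"
  proof -
    note s = quad_mult_summable[OF qd(1) q(2) sub] quad_mult_summable[OF q(3) qd(2) sub]
      quad_mult_summable[OF q(3,4) sub]
    show ?thesis
      using infsum_add[OF s(1) summable_on_add[OF s(2,3)]] infsum_add[OF s(2,3)] by simp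
  qed
  finally have split: "infsum (\<lambda>(k1, k2). f k1 * g k2) ?D = \<dots>" .

  \<comment> \<open>The poles lie at -r, ..., -(r+n-1) for \<open>U (x + real r)\<close> and at 0,
    ..., -n for \<open>G\<close>; they are disjoint when r >= n + 1.\<close>
  have 1: "infsum (\<lambda>(k1, k2). (u (Suc k1) - u k1) * g k2) ?D \<in> zspan S"
  proof -
    let ?F = "\<lambda>x. U (x + real r) * G x"
    have "pfrac ((\<lambda>i. i + r) ` {..<n} \<union> {..n}) S ?F"
      using G S A by (intro pfrac_mult[OF pfrac_shift[OF U]]) (auto simp: good_def)
    moreover have "((\<lambda>x. x * ?F x) \<longlongrightarrow> 0) at_top"
    proof -
      have "((\<lambda>x. U (x + real r)) \<longlongrightarrow> 0) at_top"
        by (rule pfrac_tendsto_0[OF pfrac_shift[OF U]])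
      moreover have "((\<lambda>x. x * G x) \<longlongrightarrow> 0) at_top"
        using G by (simp add: good_def)
      ultimately have "((\<lambda>x. U (x + real r) * (x * G x)) \<longlongrightarrow> 0 * 0) at_top"
        by (rule tendsto_mult)
      then show ?thesis by (simp add: algebra_simps)
    qed
    ultimately have "infsum (\<lambda>k. ?F (real k)) {1..} \<in> zspan S"
      using A by (intro pfrac_infsum(2)) auto
    moreover have "infsum (\<lambda>(k1, k2). (u (Suc k1) - u k1) * g k2) ?D = - infsum (\<lambda>k. ?F (real k)) {1..}"
    proof -
      have "u \<longlonglongrightarrow> 0"
        unfolding u_def by (rule tendsto_real_sequentially[OF pfrac_tendsto_0[OF U]])
      from infsum_lower_triangle_telescope[OF this qd(1) q(2)] show ?thesis
        by (simp add: infsum_uminus u_def g_def)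
    qed
    ultimately show ?thesis by (simp add: zspan_neg)
  qed

  \<comment> \<open>Here the pole -r of the power sum meets the poles -1, ..., -n of
    \<open>H (x + 1)\<close>, again disjoint when r >= n + 1. The boundary value \<open>H 1\<close>
    has to be rational, since it becomes a coefficient.\<close>
  have 2: "infsum (\<lambda>(k1, k2). \<phi> k1 * (h (Suc k2) - h k2)) ?D \<in> zspan S"
  proof -
    obtain c where c: "H 1 = of_rat c"
      using pfrac_rational_value[OF H, of 1] by auto
    let ?p = "\<lambda>x. \<Sum>s=2..A. of_rat (P s) * (1 / (x + real r) ^ s)"
    let ?I = "{r} \<union> (\<lambda>i. i + 1) ` {..<n}"
    have p: "pfrac {r} A ?p"
      by (intro pfrac_sum pfrac_scale pfrac_basis) auto
    have "pfrac ?I S (\<lambda>x. ?p x * H (x + real 1) + of_rat (- c) * ?p x)"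
    proof (intro pfrac_add pfrac_scale)
      show "pfrac ?I S (\<lambda>x. ?p x * H (x + real 1))"
        using S A by (intro pfrac_mult[OF p pfrac_shift[OF H]]) auto
      show "pfrac ?I S ?p"
        using A by (intro pfrac_mono[OF p]) auto
    qed
    then have "pfrac ?I S (\<lambda>x. ?p x * (H (x + 1) - H 1))"
      by (simp add: c of_rat_minus algebra_simps)
    \<comment> \<open>The second factor only tends to the constant -H(1); the decay comes from
      \<open>?p\<close>, whose exponents are at least 2.\<close>
    moreover have "((\<lambda>x. x * (?p x * (H (x + 1) - H 1))) \<longlongrightarrow> 0) at_top"
    proof -
      have "((\<lambda>x. H (x + real 1)) \<longlongrightarrow> 0) at_top"
        by (rule pfrac_tendsto_0[OF pfrac_shift[OF H]])
      then have "((\<lambda>x. H (x + 1) - H 1) \<longlongrightarrow> 0 - H 1) at_top"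
        by (intro tendsto_diff) auto
      moreover have "((\<lambda>x. \<Sum>s=2..A. of_rat (P s) * (x * (1 / (x + real r) ^ s))) \<longlongrightarrow> (\<Sum>s=2..A. of_rat (P s) * 0)) at_top"
        by (intro tendsto_sum tendsto_mult tendsto_const x_inverse_power_tendsto_0) auto
      ultimately have "((\<lambda>x. (\<Sum>s=2..A. of_rat (P s) * (x * (1 / (x + real r) ^ s))) * (H (x + 1) - H 1))
          \<longlongrightarrow> (\<Sum>s=2..A. of_rat (P s) * 0) * (0 - H 1)) at_top"
        by (intro tendsto_mult)
      moreover have "(\<Sum>s=2..A. of_rat (P s) * (x * (1 / (x + real r) ^ s))) = x * ?p x" for x
        by (simp add: sum_distrib_left mult.commute)
      ultimately show ?thesis by (simp add: mult.assoc)
    qed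
    ultimately have "infsum (\<lambda>k. ?p (real k) * (H (real k + 1) - H 1)) {1..} \<in> zspan S"
      using A by (intro pfrac_infsum(2)) auto
    moreover have "infsum (\<lambda>(k1, k2). \<phi> k1 * (h (Suc k2) - h k2)) ?D
       = infsum (\<lambda>k. ?p (real k) * (H (real k + 1) - H 1)) {1..}"
      by (subst infsum_upper_triangle_telescope[OF q(3) qd(2)]) (simp add: \<phi>_def h_def add_ac)
    ultimately show ?thesis by simp
  qed

  have 3: "infsum (\<lambda>(k1, k2). \<phi> k1 * \<psi> k2) ?D
     - (\<Sum>s=2..A. \<Sum>t=2..A. of_rat (P s * Q t) * zeta2 s t) \<in> zspan S"
  proof -
    define T where "T s t = infsum (\<lambda>(k1, k2). 1 / real (k1 + r) ^ s * (1 / real k2 ^ t)) ?D" for s t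
    have "((\<lambda>k. \<Sum>s=2..A. \<Sum>t=2..A. of_rat (P s * Q t) * (case k of (k1, k2) \<Rightarrow> 1 / real (k1 + r) ^ s * (1 / real k2 ^ t)))
        has_sum (\<Sum>s=2..A. \<Sum>t=2..A. of_rat (P s * Q t) * T s t)) ?D"
      unfolding T_def
      by (intro has_sum_finite_sum has_sum_cmult_right has_sum_infsum quad_mult_summable sub
          quad_shift[OF quad_inverse_power] quad_inverse_power) auto
    moreover have "(\<Sum>s=2..A. \<Sum>t=2..A. of_rat (P s * Q t) * (case k of (k1, k2) \<Rightarrow> 1 / real (k1 + r) ^ s * (1 / real k2 ^ t)))
        = (case k of (k1, k2) \<Rightarrow> \<phi> k1 * \<psi> k2)" for k
      by (cases k, simp only: prod.case \<phi>_def \<psi>_def sum_product, intro sum.cong refl) (simp add: of_rat_mult)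
    ultimately have "infsum (\<lambda>(k1, k2). \<phi> k1 * \<psi> k2) ?D = (\<Sum>s=2..A. \<Sum>t=2..A. of_rat (P s * Q t) * T s t)"
      by (intro infsumI) simp
    then have "infsum (\<lambda>(k1, k2). \<phi> k1 * \<psi> k2) ?D - (\<Sum>s=2..A. \<Sum>t=2..A. of_rat (P s * Q t) * zeta2 s t)
       = (\<Sum>s=2..A. \<Sum>t=2..A. of_rat (P s * Q t) * (T s t - zeta2 s t))"
      by (simp add: right_diff_distrib sum_subtractf)
    also have "\<dots> \<in> zspan S"
    proof (intro zspan_sum zspan_scale)
      \<comment> \<open>For r = 0 the alternative n + 1 <= r fails, so 2A <= S is available.\<close>
      fix s t assume "s \<in> {2..A}" "t \<in> {2..A}"
      then show "T s t - zeta2 s t \<in> zspan S"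
        unfolding T_def using A S by (intro triangle_power_sum[of s A t]) auto
    qed
    finally show ?thesis .
  qed
  have "infsum (\<lambda>(k1, k2). f k1 * g k2) ?D - (\<Sum>s=2..A. \<Sum>t=2..A. of_rat (P s * Q t) * zeta2 s t) \<in> zspan S"
    unfolding split using zspan_add[OF 1 zspan_add[OF 2 3]] by (simp add: algebra_simps)
  then show ?thesis by (simp add: f_def g_def)
qed

section \<open>The rational functions of the series\<close>

text \<open>The point -n/2 is fixed by x -> -n - x, so powers of x + n/2 only change sign under the
  reflection. For x = k1 + r and y = k2, the sum and the difference of x + n/2 and y + n/2 are
  exactly the two factors of the numerator.\<close>

definition centred_ratfun :: "nat \<Rightarrow> nat \<Rightarrow> nat \<Rightarrow> real \<Rightarrow> real" where
  "centred_ratfun n A a x = (x + real n / 2) ^ a / pochhammer x (n + 1) ^ A"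

text \<open>Each new factor has its pole away from the earlier ones, so the order stays
  \<open>A\<close>.\<close>

lemma pfrac_inverse_pochhammer:
  assumes "1 \<le> A"
  shows "pfrac {..n} A (\<lambda>x. 1 / pochhammer x (n + 1) ^ A)"
proof (induction n)
  case 0
  show ?case using pfrac_basis[of "{..0}" 0 A A] assms by simp
next
  case (Suc n)
  have "pfrac ({..n} \<union> {Suc n}) A (\<lambda>x. 1 / pochhammer x (n + 1) ^ A * (1 / (x + real (Suc n)) ^ A))"
    using assms by (intro pfrac_mult[OF Suc.IH pfrac_basis[of "{Suc n}" "Suc n" A A]]) auto
  moreover have "{..n} \<union> {Suc n} = {..Suc n}" by auto
  moreover have "1 / pochhammer x (n + 1) ^ A * (1 / (x + real (Suc n)) ^ A) = 1 / pochhammer x (Suc n + 1) ^ A" for x :: real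
    by (simp add: pochhammer_Suc[of x "Suc n"] power_mult_distrib del: of_nat_Suc)
  ultimately show ?case by simp
qed

lemma x_centred_ratfun_tendsto_0:
  assumes "a + 2 \<le> A * (n + 1)"
  shows "((\<lambda>x. x * centred_ratfun n A a x) \<longlongrightarrow> 0) at_top"
proof (rule Lim_null_comparison)
  \<comment> \<open>For x >= 1, x + n/2 <= (1+n) x and the Pochhammer product is at least x^(n+1);
    the two spare degrees leave 1/x after multiplication by x.\<close>
  show "((\<lambda>x::real. (1 + real n) ^ a / x) \<longlongrightarrow> 0) at_top"
    by real_asymp
  show "\<forall>\<^sub>F x in at_top. norm (x * centred_ratfun n A a x) \<le> (1 + real n) ^ a / x"
    using eventually_ge_at_top[of 1]
  proof eventually_elim
    case (elim x)
    have "x ^ (n + 1) \<le> pochhammer x (n + 1)"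
      using elim prod_mono[of "{0..<n+1}" "\<lambda>_. x" "\<lambda>i. x + real i"]
      by (simp add: pochhammer_prod)
    then have "(x ^ (n + 1)) ^ A \<le> pochhammer x (n + 1) ^ A"
      using elim by (intro power_mono) auto
    then have den: "x ^ (A * (n + 1)) \<le> pochhammer x (n + 1) ^ A"
      by (simp only: mult.commute[of A] power_mult)
    have "x + real n / 2 \<le> (1 + real n) * x"
      using elim mult_left_mono[of 1 x "real n"] by (simp add: algebra_simps)
    then have "(x + real n / 2) ^ a \<le> ((1 + real n) * x) ^ a"
      using elim by (intro power_mono) auto
    then have num: "x * (x + real n / 2) ^ a \<le> (1 + real n) ^ a * x ^ (a + 1)"
      using elim by (simp add: power_mult_distrib mult.left_commute)
    have "x ^ (a + 2) \<le> x ^ (A * (n + 1))"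
      using elim assms by (intro power_increasing) auto
    then have den': "x ^ (a + 2) \<le> pochhammer x (n + 1) ^ A" using den by simp
    have "x * (x + real n / 2) ^ a / pochhammer x (n + 1) ^ A \<le> (1 + real n) ^ a * x ^ (a + 1) / x ^ (a + 2)"
      using elim num den' by (intro frac_le) auto
    also have "\<dots> = (1 + real n) ^ a / x"
      using elim by simp
    finally have "x * centred_ratfun n A a x \<le> (1 + real n) ^ a / x"
      by (simp add: centred_ratfun_def)
    moreover have "0 \<le> x * centred_ratfun n A a x"
      using elim by (simp add: centred_ratfun_def pochhammer_nonneg)
    ultimately show ?case by simp
  qed
qed

text \<open>Induction on the exponent replaces polynomial division: a factor x + n/2 can only create
  the constant \<open>\<Sum>i\<le>n. p i 1\<close>, which vanishes while the previous function
  satisfies x F(x) -> 0. Hence a + 1 <= A(n+1) suffices, one less than the decay condition.\<close>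

lemma pfrac_centred_ratfun:
  assumes "1 \<le> A" "a + 1 \<le> A * (n + 1)"
  shows "pfrac {..n} A (centred_ratfun n A a)"
  using assms(2)
proof (induction a)
  case 0
  show ?case using pfrac_inverse_pochhammer[OF assms(1), of n] by (simp add: centred_ratfun_def[abs_def])
next
  case (Suc a)
  then have "pfrac {..n} A (centred_ratfun n A a)" by simp
  then obtain p where p: "\<And>x. (\<And>i. i \<in> {..n} \<Longrightarrow> x + real i \<noteq> 0) \<Longrightarrow> centred_ratfun n A a x = pf {..n} A p x"
    by (rule pfracE) auto
  have "((\<lambda>x. x * centred_ratfun n A a x) \<longlongrightarrow> 0) at_top"
    using Suc.prems by (intro x_centred_ratfun_tendsto_0) simp
  then have z: "(\<Sum>i\<le>n. p i 1) = 0"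
    using residue_sum_0[OF p] assms(1) by simp
  \<comment> \<open>From x + n/2 = (x + i) + (n/2 - i): the first part lowers the order, the second
    rescales. The constants arising at s = 1 are left out here; they add up to the residue
    sum.\<close>
  let ?G = "\<lambda>x. \<Sum>i\<le>n. \<Sum>s=1..A. of_rat (p i s) * (if s = 1 then 0 else 1 / (x + real i) ^ (s - 1))
     + of_rat (p i s * (of_nat n / 2 - of_nat i)) * (1 / (x + real i) ^ s)"
  have basis: "pfrac {..n} A (\<lambda>x. if s = 1 then 0 else 1 / (x + real i) ^ (s - 1))"
    if "i \<le> n" "s \<in> {1..A}" for i s
    using that by (cases "s = 1") (auto simp: pfrac_zero intro!: pfrac_basis)
  have "pfrac {..n} A ?G"
    by (intro pfrac_sum pfrac_add pfrac_scale basis pfrac_basis) auto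
  then show ?case
  proof (rule pfrac_cong)
    fix x :: real assume x: "\<And>i. i \<in> {..n} \<Longrightarrow> x + real i \<noteq> 0"
    have "centred_ratfun n A (Suc a) x = (x + real n / 2) * centred_ratfun n A a x"
      by (simp add: centred_ratfun_def)
    also have "\<dots> = (x + real n / 2) * pf {..n} A p x"
      by (simp only: p[OF x])
    also have "\<dots> = (\<Sum>i\<le>n. \<Sum>s=1..A. (if s = 1 then of_rat (p i s) else 0)
        + (of_rat (p i s) * (if s = 1 then 0 else 1 / (x + real i) ^ (s - 1))
     + of_rat (p i s * (of_nat n / 2 - of_nat i)) * (1 / (x + real i) ^ s)))"
      unfolding pf_def sum_distrib_left
    proof (intro sum.cong refl)
      fix i s assume is': "i \<in> {..n}" "s \<in> {1..A}"
      then obtain t where t: "s = Suc t" by (cases s) auto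
      have nz: "x + real i \<noteq> 0" using x is' by simp
      have e: "of_rat (p i s * (of_nat n / 2 - of_nat i)) = of_rat (p i s) * (real n / 2 - real i)"
        by (simp add: of_rat_mult of_rat_diff of_rat_divide)
      have "(x + real n / 2) * (of_rat (p i s) / (x + real i) ^ s)
        = (x + real i) * (of_rat (p i s) / (x + real i) ^ s) + (real n / 2 - real i) * (of_rat (p i s) / (x + real i) ^ s)"
        by (simp add: algebra_simps add_divide_distrib diff_divide_distrib)
      also have "(x + real i) * (of_rat (p i s) / (x + real i) ^ s) = of_rat (p i s) / (x + real i) ^ t"
        using nz by (simp add: t)
      finally show "(x + real n / 2) * (of_rat (p i s) / (x + real i) ^ s) = (if s = 1 then of_rat (p i s) else 0)
        + (of_rat (p i s) * (if s = 1 then 0 else 1 / (x + real i) ^ (s - 1))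
     + of_rat (p i s * (of_nat n / 2 - of_nat i)) * (1 / (x + real i) ^ s))"
        unfolding e by (auto simp: t)
    qed
    also have "\<dots> = (\<Sum>i\<le>n. \<Sum>s=1..A. (if s = 1 then of_rat (p i s) else 0)) + ?G x"
      by (simp only: sum.distrib)
    also have "(\<Sum>i\<le>n. \<Sum>s=1..A. (if s = 1 then of_rat (p i s) else 0)) = (of_rat (\<Sum>i\<le>n. p i 1) :: real)"
      using assms(1) by (simp add: of_rat_sum)
    finally show "centred_ratfun n A (Suc a) x = ?G x" using z by simp
  qed
qed

text \<open>The substitution reverses the factors x, ..., x + n and negates each of them; it also
  negates x + n/2.\<close>

lemma centred_ratfun_reflect:
  "centred_ratfun n A a (- real n - x) = (- 1) ^ (a + A * (n + 1)) * centred_ratfun n A a x"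
proof -
  have "pochhammer (- real n - x) (n + 1) = (- 1) ^ (n + 1) * pochhammer x (n + 1)"
    using pochhammer_minus[of "real n + x" "n + 1"] by simp
  then have "pochhammer (- real n - x) (n + 1) ^ A = (- 1) ^ (A * (n + 1)) * pochhammer x (n + 1) ^ A"
    by (simp only: power_mult_distrib power_mult[symmetric] mult.commute[of A])
  moreover have "(- real n - x + real n / 2) ^ a = (- 1) ^ a * (x + real n / 2) ^ a"
  proof -
    have "- real n - x + real n / 2 = (- 1) * (x + real n / 2)" by simp
    then show ?thesis by (metis power_mult_distrib)
  qed
  moreover have "1 / (- 1) ^ m = ((- 1) ^ m :: real)" for m
    by (cases "even m") auto
  ultimately show ?thesis
    unfolding centred_ratfun_def power_add
    by (simp add: divide_simps)
qed

text \<open>Averaging over the reflection \<open>x \<mapsto> - n - x\<close> makes the coefficients symmetric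
  without appealing to the uniqueness of partial fractions.\<close>

lemma good_centred_ratfun:
  assumes "1 \<le> A" "a + 2 \<le> A * (n + 1)"
  shows "\<exists>P. good n A P (centred_ratfun n A a) \<and> (\<forall>s. odd (s + a + A * (n + 1)) \<longrightarrow> P s = 0)"
proof -
  have "pfrac {..n} A (centred_ratfun n A a)"
    using assms by (intro pfrac_centred_ratfun) auto
  then obtain p where p: "\<And>x. (\<And>i. i \<in> {..n} \<Longrightarrow> x + real i \<noteq> 0) \<Longrightarrow> centred_ratfun n A a x = pf {..n} A p x"
    by (rule pfracE) auto
  define \<epsilon> :: rat where "\<epsilon> = (- 1) ^ (a + A * (n + 1))"
  \<comment> \<open>The second half is the coefficient after reflection: \<open>(- 1) ^ s\<close>
    comes from (-(x+i))^s, and \<open>\<epsilon>\<close>, its own inverse, undoes the sign acquired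
    by the function.\<close>
  define p' where "p' i s = (p i s + \<epsilon> * (- 1) ^ s * p (n - i) s) / 2" for i s
  have eps: "of_rat \<epsilon> = ((- 1) ^ (a + A * (n + 1)) :: real)"
    by (simp add: \<epsilon>_def of_rat_power of_rat_minus)
  have p': "centred_ratfun n A a x = pf {..n} A p' x"
    if x: "\<And>i. i \<in> {..n} \<Longrightarrow> x + real i \<noteq> 0" for x
  proof -
    have "(- real n - x) + real i \<noteq> 0" if "i \<in> {..n}" for i
      using x[of "n - i"] that by (auto simp: of_nat_diff)
    then have "centred_ratfun n A a (- real n - x) = pf {..n} A p (- real n - x)"
      by (rule p)
    also have "\<dots> = (\<Sum>i\<le>n. \<Sum>s=1..A. of_rat (p (n - i) s) / (- real n - x + real (n - i)) ^ s)"
      unfolding pf_def using sum.nat_diff_reindex[of "\<lambda>i. \<Sum>s=1..A. of_rat (p i s) / (- real n - x + real i) ^ s" "Suc n"]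
      by (simp add: lessThan_Suc_atMost)
    also have "\<dots> = (\<Sum>i\<le>n. \<Sum>s=1..A. (- 1) ^ s * of_rat (p (n - i) s) / (x + real i) ^ s)"
    proof (intro sum.cong refl)
      fix i s assume "i \<in> {..n}"
      then have "- real n - x + real (n - i) = - (x + real i)" by (simp add: of_nat_diff)
      then show "of_rat (p (n - i) s) / (- real n - x + real (n - i)) ^ s = (- 1) ^ s * of_rat (p (n - i) s) / (x + real i) ^ s"
        by (simp only: power_minus[of "x + real i"]) (cases "even s"; simp)
    qed
    finally have "of_rat \<epsilon> * centred_ratfun n A a x
       = (\<Sum>i\<le>n. \<Sum>s=1..A. (- 1) ^ s * of_rat (p (n - i) s) / (x + real i) ^ s)"
      by (simp add: centred_ratfun_reflect eps)
    moreover have "of_rat \<epsilon> * (of_rat \<epsilon> :: real) = 1"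
      unfolding eps by (simp flip: power_add)
    ultimately have r: "centred_ratfun n A a x
       = of_rat \<epsilon> * (\<Sum>i\<le>n. \<Sum>s=1..A. (- 1) ^ s * of_rat (p (n - i) s) / (x + real i) ^ s)"
      by (metis mult.assoc mult_1)
    have "pf {..n} A p' x = (pf {..n} A p x
       + of_rat \<epsilon> * (\<Sum>i\<le>n. \<Sum>s=1..A. (- 1) ^ s * of_rat (p (n - i) s) / (x + real i) ^ s)) / 2"
      unfolding pf_def sum_distrib_left sum.distrib[symmetric] sum_divide_distrib
      by (intro sum.cong refl)
        (simp add: p'_def of_rat_add of_rat_divide of_rat_mult of_rat_power of_rat_minus add_divide_distrib mult.assoc mult.commute[of _ 2])
    then show ?thesis using p[OF x] r by simp
  qed
  have lim: "((\<lambda>x. x * centred_ratfun n A a x) \<longlongrightarrow> 0) at_top"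
    using assms by (intro x_centred_ratfun_tendsto_0) auto
  have z: "(\<Sum>i\<le>n. p' i 1) = 0"
    using residue_sum_0[OF p' lim] assms(1) by simp
  have pos: "centred_ratfun n A a x = pf {..n} A p' x" if "0 < x" for x
    using that by (intro p') linarith
  have "good n A (\<lambda>s. \<Sum>i\<le>n. p' i s) (centred_ratfun n A a)"
    unfolding good_def
  proof (intro conjI)
    show "pfrac {..n} A (centred_ratfun n A a)" by (rule pfracI[OF p'])
    show "\<exists>U. pfrac {..<n} A U \<and> (\<forall>x>0. centred_ratfun n A a x =
        (\<Sum>s=2..A. of_rat (\<Sum>i\<le>n. p' i s) / x ^ s) + (U (x + 1) - U x))"
      using pf_telescope[where p = p', OF z assms(1)] by (simp add: pos)
  qed (rule lim)
  \<comment> \<open>For this parity the two halves of \<open>p'\<close> enter with opposite signs,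
    and summation over i is invariant under i -> n - i.\<close>
  moreover have "(\<Sum>i\<le>n. p' i s) = 0" if "odd (s + a + A * (n + 1))" for s
  proof -
    have "\<epsilon> * (- 1) ^ s = (- 1) ^ (s + a + A * (n + 1))"
      by (simp add: \<epsilon>_def power_add mult_ac)
    then have "\<epsilon> * (- 1) ^ s = - 1" using that by simp
    then have "(\<Sum>i\<le>n. p' i s) = ((\<Sum>i\<le>n. p i s) - (\<Sum>i\<le>n. p (n - i) s)) / 2"
      by (simp add: p'_def sum_subtractf flip: sum_divide_distrib)
    also have "(\<Sum>i\<le>n. p (n - i) s) = (\<Sum>i\<le>n. p i s)"
      using sum.nat_diff_reindex[of "\<lambda>i. p i s" "Suc n"] by (simp add: lessThan_Suc_atMost)
    finally show ?thesis by simp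
  qed
  ultimately show ?thesis by blast
qed

section \<open>Homogeneous expansion of the numerator\<close>

lemma bihomogeneous_step:
  assumes "\<And>x y :: real. F x y = (\<Sum>a\<le>N. of_rat (m a) * x ^ a * y ^ (N - a))"
  shows "\<exists>m'. \<forall>x y. (x + of_rat c * y) * F x y = (\<Sum>a\<le>Suc N. of_rat (m' a) * x ^ a * y ^ (Suc N - a))"
proof (intro exI allI)
  fix x y :: real
  \<comment> \<open>Pascal-type rule m(a-1) + c m(a), used with c = 1 and c = -1. The guards matter
    at the ends: truncated subtraction would repeat m(0) at a = 0, and m(N+1) is arbitrary.\<close>
  have "(\<Sum>a\<le>Suc N. of_rat ((if a = 0 then 0 else m (a - 1)) + (if a \<le> N then c * m a else 0)) * x ^ a * y ^ (Suc N - a))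
    = (\<Sum>a\<le>Suc N. (if a = 0 then 0 else of_rat (m (a - 1))) * x ^ a * y ^ (Suc N - a))
    + (\<Sum>a\<le>Suc N. (if a \<le> N then of_rat (c * m a) else 0) * x ^ a * y ^ (Suc N - a))"
    unfolding sum.distrib[symmetric] by (intro sum.cong refl) (auto simp: of_rat_add algebra_simps)
  also have "(\<Sum>a\<le>Suc N. (if a = 0 then 0 else of_rat (m (a - 1))) * x ^ a * y ^ (Suc N - a)) = x * F x y"
    unfolding assms sum.atMost_Suc_shift sum_distrib_left by (auto intro!: sum.cong simp: mult_ac)
  also have "(\<Sum>a\<le>Suc N. (if a \<le> N then of_rat (c * m a) else 0) * x ^ a * y ^ (Suc N - a)) = of_rat c * y * F x y"
  proof -
    have "(\<Sum>a\<le>Suc N. (if a \<le> N then of_rat (c * m a) else 0) * x ^ a * y ^ (Suc N - a))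
      = (\<Sum>a\<le>N. (if a \<le> N then of_rat (c * m a) else 0) * x ^ a * y ^ (Suc N - a))"
      by simp
    also have "\<dots> = (\<Sum>a\<le>N. of_rat c * y * (of_rat (m a) * x ^ a * y ^ (N - a)))"
      by (rule sum.cong) (auto simp: of_rat_mult Suc_diff_le)
    finally show ?thesis
      by (simp only: assms sum_distrib_left)
  qed
  finally show "(x + of_rat c * y) * F x y = (\<Sum>a\<le>Suc N. of_rat ((if a = 0 then 0 else m (a - 1)) + (if a \<le> N then c * m a else 0)) * x ^ a * y ^ (Suc N - a))"
    by (simp add: algebra_simps)
qed

lemma expansion_exists:
  "\<exists>m. \<forall>x y :: real. (x + y) ^ e * (x - y) ^ f = (\<Sum>a\<le>e+f. of_rat (m a) * x ^ a * y ^ (e + f - a))"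
proof (induction e)
  case 0
  show ?case
  proof (induction f)
    case 0
    show ?case by (intro exI[of _ "\<lambda>_. 1"]) simp
  next
    case (Suc f)
    then obtain m where "\<And>x y :: real. (x + y) ^ 0 * (x - y) ^ f = (\<Sum>a\<le>0+f. of_rat (m a) * x ^ a * y ^ (0 + f - a))"
      by blast
    from bihomogeneous_step[OF this, of "- 1"] show ?case by (simp add: of_rat_minus)
  qed
next
  case (Suc e)
  then obtain m where "\<And>x y :: real. (x + y) ^ e * (x - y) ^ f = (\<Sum>a\<le>e+f. of_rat (m a) * x ^ a * y ^ (e + f - a))"
    by blast
  from bihomogeneous_step[OF this, of 1] show ?case by (simp add: mult.assoc)
qed

text \<open>Swapping x and y multiplies the left side by (-1)^f. Averaging an expansion with its
  swapped copy forces the same sign on the coefficients, without their uniqueness.\<close>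

lemma symmetric_expansion_exists:
  "\<exists>m. (\<forall>x y :: real. (x + y) ^ e * (x - y) ^ f = (\<Sum>a\<le>e+f. of_rat (m a) * x ^ a * y ^ (e + f - a)))
    \<and> (\<forall>a\<le>e+f. m (e + f - a) = (- 1) ^ f * m a)"
proof -
  let ?N = "e + f"
  obtain m where m: "\<And>x y :: real. (x + y) ^ e * (x - y) ^ f = (\<Sum>a\<le>?N. of_rat (m a) * x ^ a * y ^ (?N - a))"
    using expansion_exists by blast
  define m' where "m' a = (m a + (- 1) ^ f * m (?N - a)) / 2" for a
  have "(x + y) ^ e * (x - y) ^ f = (\<Sum>a\<le>?N. of_rat (m' a) * x ^ a * y ^ (?N - a))" for x y :: real
  proof -
    have "(y + x) ^ e * (y - x) ^ f = (\<Sum>a\<le>?N. of_rat (m (?N - a)) * y ^ (?N - a) * x ^ a)"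
      unfolding m using sum.nat_diff_reindex[of "\<lambda>a. of_rat (m a) * y ^ a * x ^ (?N - a)" "Suc ?N"]
      by (simp add: lessThan_Suc_atMost)
    moreover have "(x + y) ^ e * (x - y) ^ f = (- 1) ^ f * ((y + x) ^ e * (y - x) ^ f)"
    proof -
      have "(x - y) ^ f = (- 1) ^ f * (y - x) ^ f"
        by (metis minus_diff_eq power_minus)
      then show ?thesis by (simp add: add.commute)
    qed
    ultimately have "(x + y) ^ e * (x - y) ^ f = ((\<Sum>a\<le>?N. of_rat (m a) * x ^ a * y ^ (?N - a))
        + (- 1) ^ f * (\<Sum>a\<le>?N. of_rat (m (?N - a)) * y ^ (?N - a) * x ^ a)) / 2"
      using m[of x y] by simp
    also have "\<dots> = (\<Sum>a\<le>?N. of_rat (m' a) * x ^ a * y ^ (?N - a))"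
      unfolding sum_distrib_left sum.distrib[symmetric] sum_divide_distrib
      by (intro sum.cong refl)
        (simp add: m'_def of_rat_add of_rat_mult of_rat_divide of_rat_power of_rat_minus field_simps)
    finally show ?thesis .
  qed
  moreover have "m' (?N - a) = (- 1) ^ f * m' a" if "a \<le> ?N" for a
    using that by (cases "even f") (auto simp: m'_def field_simps)
  ultimately show ?thesis by blast
qed

section \<open>The double series\<close>

lemma double_series_decomposition:
  assumes "e + f + 2 \<le> A * (n + 1)" "A \<le> S" "n + 1 \<le> r \<or> 2 * A \<le> S"
  shows "double_series_term A n r e f summable_on double_series_index"
    and "\<exists>C. (\<forall>s t. C t s = (- 1) ^ f * C s t) \<and> (\<forall>s t. odd (s + t + e + f) \<longrightarrow> C s t = 0) \<and>
      infsum (double_series_term A n r e f) double_series_index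
        - (\<Sum>s=2..A. \<Sum>t=2..A. of_rat (C s t) * zeta2 s t) \<in> zspan S"
proof -
  let ?D = double_series_index and ?N = "e + f"
  have A: "1 \<le> A" using assms(1) by (cases A) auto
  obtain m where m: "\<And>x y :: real. (x + y) ^ e * (x - y) ^ f = (\<Sum>a\<le>?N. of_rat (m a) * x ^ a * y ^ (?N - a))"
    and m_sym: "\<And>a. a \<le> ?N \<Longrightarrow> m (?N - a) = (- 1) ^ f * m a"
    using symmetric_expansion_exists[of e f] by blast
  \<comment> \<open>The implication sits under the existential so that choice yields one family
    \<open>P\<close>. The symmetry of \<open>C\<close> rests on \<open>P a\<close> and
    \<open>P (?N - a)\<close> being members of the same family.\<close>
  have "\<exists>P. a \<le> ?N \<longrightarrow> good n A P (centred_ratfun n A a) \<and> (\<forall>s. odd (s + a + A * (n + 1)) \<longrightarrow> P s = 0)" for a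
  proof (cases "a \<le> ?N")
    case True
    then have "a + 2 \<le> A * (n + 1)" using assms(1) by linarith
    from good_centred_ratfun[OF A this] show ?thesis by blast
  qed simp
  then have "\<forall>a. \<exists>P. a \<le> ?N \<longrightarrow> good n A P (centred_ratfun n A a) \<and> (\<forall>s. odd (s + a + A * (n + 1)) \<longrightarrow> P s = 0)" ..
  from choice[OF this] obtain P where P: "\<And>a. a \<le> ?N \<Longrightarrow> good n A (P a) (centred_ratfun n A a)"
    and P_odd: "\<And>a s. a \<le> ?N \<Longrightarrow> odd (s + a + A * (n + 1)) \<Longrightarrow> P a s = 0"
    by blast
  define R where "R a = (\<lambda>(k1, k2). centred_ratfun n A a (real (k1 + r)) * centred_ratfun n A (?N - a) (real k2))" for a
  define C where "C s t = (\<Sum>a\<le>?N. m a * (P a s * P (?N - a) t))" for s t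
  have quad: "quad (\<lambda>k. centred_ratfun n A a (real k))" if "a \<le> ?N" for a
    by (rule good_quad[OF P[OF that] A])
  have R_summable: "R a summable_on ?D" if "a \<le> ?N" for a
    unfolding R_def
    by (rule quad_mult_summable[OF quad_shift[OF quad] quad]) (use that in \<open>auto simp: double_series_index_def\<close>)
  have expand: "double_series_term A n r e f k = (\<Sum>a\<le>?N. of_rat (m a) * R a k)" for k
  proof (cases k)
    case (Pair k1 k2)
    let ?x = "real (k1 + r) + real n / 2" and ?y = "real k2 + real n / 2"
    have "double_series_term A n r e f k = (?x + ?y) ^ e * (?x - ?y) ^ f /
        (pochhammer (real (k1 + r)) (n + 1) ^ A * pochhammer (real k2) (n + 1) ^ A)"
    proof -
      have eqs: "?x + ?y = real k1 + real k2 + real n + real r" "?x - ?y = real k1 - real k2 + real r"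
        by simp_all
      show ?thesis
        unfolding Pair double_series_term_def prod.case eqs unfolding of_nat_add ..
    qed
    also have "\<dots> = (\<Sum>a\<le>?N. of_rat (m a) * ?x ^ a * ?y ^ (?N - a) /
        (pochhammer (real (k1 + r)) (n + 1) ^ A * pochhammer (real k2) (n + 1) ^ A))"
      by (simp only: m sum_divide_distrib)
    also have "\<dots> = (\<Sum>a\<le>?N. of_rat (m a) * R a k)"
      by (intro sum.cong refl) (simp add: Pair R_def centred_ratfun_def)
    finally show ?thesis .
  qed
  have sum: "(double_series_term A n r e f has_sum (\<Sum>a\<le>?N. of_rat (m a) * infsum (R a) ?D)) ?D"
    unfolding expand[abs_def]
    by (intro has_sum_finite_sum has_sum_cmult_right has_sum_infsum R_summable) simp
  then show "double_series_term A n r e f summable_on ?D"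
    by (rule has_sum_imp_summable)
  show "\<exists>C. (\<forall>s t. C t s = (- 1) ^ f * C s t) \<and> (\<forall>s t. odd (s + t + e + f) \<longrightarrow> C s t = 0) \<and>
      infsum (double_series_term A n r e f) ?D - (\<Sum>s=2..A. \<Sum>t=2..A. of_rat (C s t) * zeta2 s t) \<in> zspan S"
  proof (intro exI conjI allI impI)
    fix s t
    have "C t s = (\<Sum>a\<le>?N. m (?N - a) * (P (?N - a) t * P (?N - (?N - a)) s))"
      unfolding C_def using sum.nat_diff_reindex[of "\<lambda>a. m a * (P a t * P (?N - a) s)" "Suc ?N"]
      by (simp add: lessThan_Suc_atMost)
    also have "\<dots> = (- 1) ^ f * C s t"
      unfolding C_def sum_distrib_left by (intro sum.cong refl) (simp add: m_sym)
    finally show "C t s = (- 1) ^ f * C s t" .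
  next
    fix s t assume odd: "odd (s + t + e + f)"
    have "P a s * P (?N - a) t = 0" if "a \<le> ?N" for a
    proof (rule ccontr)
      assume "P a s * P (?N - a) t \<noteq> 0"
      then have "even (s + a + A * (n + 1))" "even (t + (?N - a) + A * (n + 1))"
        using P_odd[of a s] P_odd[of "?N - a" t] that by auto
      then have "even ((s + a + A * (n + 1)) + (t + (?N - a) + A * (n + 1)))"
        by (rule dvd_add)
      also have "(s + a + A * (n + 1)) + (t + (?N - a) + A * (n + 1)) = (s + t + e + f) + 2 * (A * (n + 1))"
        using that by simp
      finally show False using odd by simp
    qed
    then show "C s t = 0" unfolding C_def by (intro sum.neutral) simp
  next
    have "infsum (double_series_term A n r e f) ?D - (\<Sum>s=2..A. \<Sum>t=2..A. of_rat (C s t) * zeta2 s t)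
      = (\<Sum>a\<le>?N. of_rat (m a) * (infsum (R a) ?D - (\<Sum>s=2..A. \<Sum>t=2..A. of_rat (P a s * P (?N - a) t) * zeta2 s t)))"
    proof -
      have "(\<Sum>s=2..A. \<Sum>t=2..A. of_rat (C s t) * zeta2 s t)
         = (\<Sum>s=2..A. \<Sum>t=2..A. \<Sum>a\<le>?N. of_rat (m a) * (of_rat (P a s * P (?N - a) t) * zeta2 s t))"
        by (simp only: C_def of_rat_sum of_rat_mult[of "m _"] sum_distrib_right mult.assoc)
      also have "\<dots> = (\<Sum>s=2..A. \<Sum>a\<le>?N. \<Sum>t=2..A. of_rat (m a) * (of_rat (P a s * P (?N - a) t) * zeta2 s t))"
        by (intro sum.cong refl sum.swap)
      also have "\<dots> = (\<Sum>a\<le>?N. \<Sum>s=2..A. \<Sum>t=2..A. of_rat (m a) * (of_rat (P a s * P (?N - a) t) * zeta2 s t))"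
        by (rule sum.swap)
      finally show ?thesis
        by (simp only: infsumI[OF sum] right_diff_distrib sum_subtractf sum_distrib_left)
    qed
    also have "\<dots> \<in> zspan S"
    proof (intro zspan_sum zspan_scale)
      fix a assume "a \<in> {..?N}"
      then show "infsum (R a) ?D - (\<Sum>s=2..A. \<Sum>t=2..A. of_rat (P a s * P (?N - a) t) * zeta2 s t) \<in> zspan S"
        unfolding R_def by (intro good_double_sum[OF P P A assms(2,3)]) auto
    qed
    finally show "infsum (double_series_term A n r e f) ?D
        - (\<Sum>s=2..A. \<Sum>t=2..A. of_rat (C s t) * zeta2 s t) \<in> zspan S" .
  qed
qed

text \<open>Averaging the sum with its transpose replaces zeta(s,t) by half of zeta(s,t) + (-1)^f
  zeta(t,s). Exchanging s and t multiplies this combination by (-1)^f, so it suffices to assume s <=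
  t.\<close>

lemma symmetrized_combination_in_span:
  fixes C :: "nat \<Rightarrow> nat \<Rightarrow> rat"
  assumes sym: "\<And>s t. C t s = (- 1) ^ f * C s t"
    and odd: "\<And>s t. odd (s + t + e + f) \<Longrightarrow> C s t = 0"
    and span: "\<And>s t. 2 \<le> s \<Longrightarrow> s \<le> t \<Longrightarrow> t \<le> A \<Longrightarrow> even (s + t + e + f) \<Longrightarrow>
      zeta2 s t + (- 1) ^ f * zeta2 t s \<in> rat_span T"
  shows "(\<Sum>s=2..A. \<Sum>t=2..A. of_rat (C s t) * zeta2 s t) \<in> rat_span T"
proof -
  have sgn: "of_rat ((- 1) ^ f) = ((- 1) ^ f :: real)"
    by (simp add: of_rat_power of_rat_minus)
  have sq: "(- 1) ^ f * ((- 1) ^ f * x) = (x :: real)" for x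
    by (cases "even f") auto
  let ?Z = "\<Sum>s=2..A. \<Sum>t=2..A. of_rat (C s t) * zeta2 s t"
  have "(\<Sum>s=2..A. \<Sum>t=2..A. of_rat (C s t) * ((- 1) ^ f * zeta2 t s))
     = (\<Sum>s=2..A. \<Sum>t=2..A. of_rat (C t s) * zeta2 t s)"
    by (intro sum.cong refl) (subst sym, simp add: of_rat_mult sgn mult_ac)
  also have "\<dots> = ?Z" by (rule sum.swap)
  finally have "?Z = (\<Sum>s=2..A. \<Sum>t=2..A. of_rat (C s t / 2) * (zeta2 s t + (- 1) ^ f * zeta2 t s))"
    by (simp add: of_rat_divide distrib_left sum.distrib flip: sum_divide_distrib)
  also have "\<dots> \<in> rat_span T"
  proof (intro rat_real.span_sum)
    fix s t assume st: "s \<in> {2..A}" "t \<in> {2..A}"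
    show "of_rat (C s t / 2) * (zeta2 s t + (- 1) ^ f * zeta2 t s) \<in> rat_span T"
    proof (cases "odd (s + t + e + f)")
      case True
      then show ?thesis using odd rat_real.span_zero by simp
    next
      case False
      have "zeta2 s t + (- 1) ^ f * zeta2 t s \<in> rat_span T"
      proof (cases "s \<le> t")
        case True
        then show ?thesis using False st by (intro span) auto
      next
        case nle: False
        have "of_rat ((- 1) ^ f) * (zeta2 t s + (- 1) ^ f * zeta2 s t) \<in> rat_span T"
          using False st nle by (intro rat_real.span_scale span) (auto simp: add_ac)
        moreover have "of_rat ((- 1) ^ f) * (zeta2 t s + (- 1) ^ f * zeta2 s t) = zeta2 s t + (- 1) ^ f * zeta2 t s"
          unfolding sgn distrib_left sq by simp
        ultimately show ?thesis by simp
      qed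
      then show ?thesis by (rule rat_real.span_scale)
    qed
  qed
  finally show ?thesis .
qed

theorem theorem3p4:
  fixes A n r e f S :: nat and X :: real
  assumes "int e + int f \<le> int A * (int n + 1) - 2"
    and "S = (if r \<ge> n + 1 then A else 2 * A)"
    and "X = (\<Sum>\<^sub>\<infinity>k\<in>double_series_index. double_series_term A n r e f k)"
  shows "double_series_term A n r e f summable_on double_series_index \<and>
    (even e \<and> even f \<longrightarrow>
       X \<in> rat_span ({1} \<union> {zeta1 s | s. 2 \<le> s \<and> s \<le> S} \<union>
         {zeta2 s s' + zeta2 s' s | s s'. 2 \<le> s \<and> s \<le> s' \<and> s' \<le> A \<and> s' mod 2 = s mod 2})) \<and>
    (even e \<and> odd f \<longrightarrow>
       X \<in> rat_span ({1} \<union> {zeta1 s | s. 2 \<le> s \<and> s \<le> S} \<union>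
         {zeta2 s s' - zeta2 s' s | s s'. 2 \<le> s \<and> s < s' \<and> s' \<le> A \<and> s' mod 2 \<noteq> s mod 2})) \<and>
    (odd e \<and> even f \<longrightarrow>
       X \<in> rat_span ({1} \<union> {zeta1 s | s. 2 \<le> s \<and> s \<le> S} \<union>
         {zeta2 s s' + zeta2 s' s | s s'. 2 \<le> s \<and> s < s' \<and> s' \<le> A \<and> s' mod 2 \<noteq> s mod 2})) \<and>
    (odd e \<and> odd f \<longrightarrow>
       X \<in> rat_span ({1} \<union> {zeta1 s | s. 2 \<le> s \<and> s \<le> S} \<union>
         {zeta2 s s' - zeta2 s' s | s s'. 2 \<le> s \<and> s < s' \<and> s' \<le> A \<and> s' mod 2 = s mod 2}))"
proof -
  have bound: "e + f + 2 \<le> A * (n + 1)"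
  \<comment> \<open>Read in the integers, the bound is not truncated: it forces A(n+1) >= 2.\<close>
  proof -
    have "int (e + f + 2) \<le> int (A * (n + 1))" using assms(1) by (simp add: algebra_simps)
    then show ?thesis by (simp only: of_nat_le_iff)
  qed
  have S: "A \<le> S" "n + 1 \<le> r \<or> 2 * A \<le> S" using assms(2) by (auto split: if_splits)
  let ?B = "{1} \<union> {zeta1 s | s. 2 \<le> s \<and> s \<le> S}"
  obtain C where C: "\<And>s t. C t s = (- 1) ^ f * C s t" "\<And>s t. odd (s + t + e + f) \<Longrightarrow> C s t = 0"
    and X: "X - (\<Sum>s=2..A. \<Sum>t=2..A. of_rat (C s t) * zeta2 s t) \<in> zspan S"
    using double_series_decomposition(2)[OF bound S] unfolding assms(3) by blast
  \<comment> \<open>Shared by the four cases: each only has to recognise the combination with sign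
    (-1)^f as a generator under its parity condition.\<close>
  have main: "X \<in> rat_span (?B \<union> T)"
    if "\<And>s t. 2 \<le> s \<Longrightarrow> s \<le> t \<Longrightarrow> t \<le> A \<Longrightarrow> even (s + t + e + f) \<Longrightarrow>
      zeta2 s t + (- 1) ^ f * zeta2 t s \<in> rat_span (?B \<union> T)" for T
  proof -
    have "X - (\<Sum>s=2..A. \<Sum>t=2..A. of_rat (C s t) * zeta2 s t) \<in> rat_span (?B \<union> T)"
      using X rat_real.span_mono[of ?B "?B \<union> T"] unfolding zspan_def by blast
    moreover have "(\<Sum>s=2..A. \<Sum>t=2..A. of_rat (C s t) * zeta2 s t) \<in> rat_span (?B \<union> T)"
      by (rule symmetrized_combination_in_span[of C f e A, OF C that]; assumption)
    ultimately have "X - (\<Sum>s=2..A. \<Sum>t=2..A. of_rat (C s t) * zeta2 s t)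
        + (\<Sum>s=2..A. \<Sum>t=2..A. of_rat (C s t) * zeta2 s t) \<in> rat_span (?B \<union> T)"
      by (rule rat_real.span_add)
    then show ?thesis by (simp only: diff_add_cancel)
  qed
  show ?thesis
  proof (intro conjI impI)
    show "double_series_term A n r e f summable_on double_series_index"
      by (rule double_series_decomposition(1)[OF bound S])
  next
    assume p: "even e \<and> even f"
    show "X \<in> rat_span (?B \<union> {zeta2 s s' + zeta2 s' s | s s'. 2 \<le> s \<and> s \<le> s' \<and> s' \<le> A \<and> s' mod 2 = s mod 2})"
    proof (rule main)
      fix s t assume st: "2 \<le> s" "s \<le> t" "t \<le> A" "even (s + t + e + f)"
      then have "t mod 2 = s mod 2" using p by (auto simp: mod2_eq_if)
      then show "zeta2 s t + (- 1) ^ f * zeta2 t s \<in> rat_span (?B \<union>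
          {zeta2 s s' + zeta2 s' s | s s'. 2 \<le> s \<and> s \<le> s' \<and> s' \<le> A \<and> s' mod 2 = s mod 2})"
        using st p by (intro rat_real.span_base UnI2 CollectI exI[of _ s] exI[of _ t]) simp
    qed
  next
    assume p: "even e \<and> odd f"
    show "X \<in> rat_span (?B \<union> {zeta2 s s' - zeta2 s' s | s s'. 2 \<le> s \<and> s < s' \<and> s' \<le> A \<and> s' mod 2 \<noteq> s mod 2})"
    proof (rule main)
      fix s t assume st: "2 \<le> s" "s \<le> t" "t \<le> A" "even (s + t + e + f)"
      then have "t mod 2 \<noteq> s mod 2" using p by (auto simp: mod2_eq_if)
      moreover from this have "s < t" using st by (cases "s = t") auto
      ultimately show "zeta2 s t + (- 1) ^ f * zeta2 t s \<in> rat_span (?B \<union>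
          {zeta2 s s' - zeta2 s' s | s s'. 2 \<le> s \<and> s < s' \<and> s' \<le> A \<and> s' mod 2 \<noteq> s mod 2})"
        using st p by (intro rat_real.span_base UnI2 CollectI exI[of _ s] exI[of _ t]) simp
    qed
  next
    assume p: "odd e \<and> even f"
    show "X \<in> rat_span (?B \<union> {zeta2 s s' + zeta2 s' s | s s'. 2 \<le> s \<and> s < s' \<and> s' \<le> A \<and> s' mod 2 \<noteq> s mod 2})"
    proof (rule main)
      fix s t assume st: "2 \<le> s" "s \<le> t" "t \<le> A" "even (s + t + e + f)"
      then have "t mod 2 \<noteq> s mod 2" using p by (auto simp: mod2_eq_if)
      moreover from this have "s < t" using st by (cases "s = t") auto
      ultimately show "zeta2 s t + (- 1) ^ f * zeta2 t s \<in> rat_span (?B \<union>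
          {zeta2 s s' + zeta2 s' s | s s'. 2 \<le> s \<and> s < s' \<and> s' \<le> A \<and> s' mod 2 \<noteq> s mod 2})"
        using st p by (intro rat_real.span_base UnI2 CollectI exI[of _ s] exI[of _ t]) simp
    qed
  next
    assume p: "odd e \<and> odd f"
    show "X \<in> rat_span (?B \<union> {zeta2 s s' - zeta2 s' s | s s'. 2 \<le> s \<and> s < s' \<and> s' \<le> A \<and> s' mod 2 = s mod 2})"
    proof (rule main)
      fix s t assume st: "2 \<le> s" "s \<le> t" "t \<le> A" "even (s + t + e + f)"
      then have par: "t mod 2 = s mod 2" using p by (auto simp: mod2_eq_if)
      show "zeta2 s t + (- 1) ^ f * zeta2 t s \<in> rat_span (?B \<union>
          {zeta2 s s' - zeta2 s' s | s s'. 2 \<le> s \<and> s < s' \<and> s' \<le> A \<and> s' mod 2 = s mod 2})"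
      \<comment> \<open>For odd f the diagonal combination is zeta(s,s) - zeta(s,s) = 0, so
        generators with s < s' are enough.\<close>
      proof (cases "s = t")
        case True
        then show ?thesis using p rat_real.span_zero by simp
      next
        case False
        then show ?thesis using st p par by (intro rat_real.span_base UnI2 CollectI exI[of _ s] exI[of _ t]) simp
      qed
    qed
  qed
qed

end
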